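(* Let $\omega\in(0,2]$ and $\Omega=\varphi^{-1}([0,\omega])\subset\mathbb{T}$, where $\varphi(\xi)=1-\cos(2\pi\xi)$. Let $(\lambda_j)_{j\in\mathbb{N}}$ be a uniformly separated sequence in the open unit disc $\{z\in\mathbb{C}:|z|<1\}$, let $s:\mathbb{N}\to\mathbb{Z}$ be a bijection, and let $(e_j)_{j\ge0}$ be the orthonormal basis of $L^2(\Omega)$ given by $$e_j(\xi)=\frac{1}{\sqrt{|\Omega|}}\,\chi_\Omega(\xi)\,e^{2\pi i\frac{s(j)}{|\Omega|}\xi},\qquad j\ge0,\ \xi\in\Omega.$$ Define the operator $T$ on $L^2(\Omega)$ by $Tf=\sum_{j=0}^\infty\lambda_j\langle f,e_j\rangle e_j$, and let $a\in L^2(\Omega)$ satisfy $$|\langle a,e_j\rangle|^2\sim 1-|\lambda_j|^2 .$$ Then the system $\{T^na:n\in\mathbb{N}\}$ is a frame for $L^2(\Omega)$.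
   Context: $\mathbb{N}=\{0,1,2,\dots\}$. $\mathbb{T}$ is identified with $[-1/2,1/2)$ with addition modulo $1$ and Lebesgue measure. The set $\Omega=\varphi^{-1}([0,\omega])$ is a symmetric interval around the origin in $\mathbb{T}$; $|\Omega|$ is its length and $\chi_\Omega$ its characteristic function. $L^2(\Omega)=\{g\in L^2(\mathbb{T}):g(\xi)=0\text{ for a.e. }\xi\in\mathbb{T}\setminus\Omega\}$. A sequence $(\lambda_j)_{j\in\mathbb{N}}$ in the open unit disc is uniformly separated if $\inf_{j\in\mathbb{N}}\prod_{k\ne j}\left|\frac{\lambda_j-\lambda_k}{1-\overline{\lambda_k}\lambda_j}\right|>0$. For nonnegative sequences, $a_j\sim b_j$ means there exist constants $c,C>0$ with $c\,a_j\le b_j\le C\,a_j$ for all $j\in\mathbb{N}$. A sequence $(f_n)$ in a Hilbert space $\mathcal{H}$ is a frame for $\mathcal{H}$ if there are constants $A,B>0$ with $A\|f\|^2\le\sum_n|\langle f,f_n\rangle|^2\le B\|f\|^2$ for all $f\in\mathcal{H}$. *)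

theory Defs
  imports "HOL-Analysis.Analysis"
begin

text \<open>Elements of \<open>L\<^sup>2\<close> spaces are handled through representatives: square-integrable
  functions, with almost everywhere equal functions understood as the same vector.  A function
  on the torus is a function on the reals of which only the values on \<open>[-1/2, 1/2)\<close> matter.\<close>

definition torus :: "real set" where
  "torus = {-1/2..<1/2}"

abbreviation torus_measure :: "real measure" where
  "torus_measure \<equiv> lebesgue_on torus"

definition L2_torus :: "(real \<Rightarrow> complex) set" where
  "L2_torus = {f \<in> borel_measurable torus_measure.
                 integrable torus_measure (\<lambda>\<xi>. (cmod (f \<xi>))\<^sup>2)}"

definition L2_on :: "real set \<Rightarrow> (real \<Rightarrow> complex) set" where
  "L2_on \<Omega> = {f \<in> L2_torus. AE \<xi> in torus_measure. \<xi> \<notin> \<Omega> \<longrightarrow> f \<xi> = 0}"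

definition L2_inner :: "(real \<Rightarrow> complex) \<Rightarrow> (real \<Rightarrow> complex) \<Rightarrow> complex" where
  "L2_inner f g = (LINT \<xi>|torus_measure. f \<xi> * cnj (g \<xi>))"

definition L2_norm :: "(real \<Rightarrow> complex) \<Rightarrow> real" where
  "L2_norm f = sqrt (LINT \<xi>|torus_measure. (cmod (f \<xi>))\<^sup>2)"

text \<open>\<open>g\<close> is (a representative of) the norm limit in \<open>L\<^sup>2(\<Omega>)\<close> of the series with terms \<open>u\<close>.\<close>

definition L2_sums :: "real set \<Rightarrow> (nat \<Rightarrow> real \<Rightarrow> complex) \<Rightarrow> (real \<Rightarrow> complex) \<Rightarrow> bool" where
  "L2_sums \<Omega> u g \<longleftrightarrow> (\<forall>j. u j \<in> L2_on \<Omega>) \<and> g \<in> L2_on \<Omega> \<and>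
     (\<lambda>N. L2_norm (\<lambda>\<xi>. g \<xi> - (\<Sum>j<N. u j \<xi>))) \<longlonglongrightarrow> 0"

definition L2_frame :: "real set \<Rightarrow> (nat \<Rightarrow> real \<Rightarrow> complex) \<Rightarrow> bool" where
  "L2_frame \<Omega> u \<longleftrightarrow> (\<forall>n. u n \<in> L2_on \<Omega>) \<and>
     (\<exists>A>0. \<exists>B>0. \<forall>f\<in>L2_on \<Omega>.
        summable (\<lambda>n. (cmod (L2_inner f (u n)))\<^sup>2) \<and>
        A * (L2_norm f)\<^sup>2 \<le> (\<Sum>n. (cmod (L2_inner f (u n)))\<^sup>2) \<and>
        (\<Sum>n. (cmod (L2_inner f (u n)))\<^sup>2) \<le> B * (L2_norm f)\<^sup>2)"

definition phi :: "real \<Rightarrow> real" where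
  "phi \<xi> = 1 - cos (2 * pi * \<xi>)"

definition Omega :: "real \<Rightarrow> real set" where
  "Omega \<omega> = {\<xi> \<in> torus. phi \<xi> \<in> {0..\<omega>}}"

definition exp_basis :: "real set \<Rightarrow> (nat \<Rightarrow> int) \<Rightarrow> nat \<Rightarrow> real \<Rightarrow> complex" where
  "exp_basis \<Omega> s j \<xi> =
     complex_of_real (1 / sqrt (measure lebesgue \<Omega>)) * indicator \<Omega> \<xi> *
     exp (2 * complex_of_real pi * \<i> *
          complex_of_real (real_of_int (s j) / measure lebesgue \<Omega> * \<xi>))"

text \<open>The infinite product is the limit of its partial products, which decrease in \<open>[0, 1]\<close> for
  points of the disc; it may be \<open>0\<close>.  The library's \<open>prodinf\<close> is not used because it is
  unspecified for products diverging to \<open>0\<close>.\<close>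

definition uniformly_separated :: "(nat \<Rightarrow> complex) \<Rightarrow> bool" where
  "uniformly_separated l \<longleftrightarrow> (\<forall>j. cmod (l j) < 1) \<and>
     (INF j. lim (\<lambda>N. \<Prod>k\<in>{..<N} - {j}. cmod ((l j - l k) / (1 - cnj (l k) * l j)))) > 0"

definition comparable_seqs :: "(nat \<Rightarrow> real) \<Rightarrow> (nat \<Rightarrow> real) \<Rightarrow> bool" where
  "comparable_seqs x y \<longleftrightarrow> (\<exists>c>0. \<exists>C>0. \<forall>j. c * x j \<le> y j \<and> y j \<le> C * x j)"

end

theory Submission
  imports Defs
    "HOL-Complex_Analysis.Cauchy_Integral_Formula"
    "HOL-Computational_Algebra.Polynomial"
begin

text \<open>
  The operator \<open>T\<close> is diagonal with respect to the orthonormal basis \<open>e\<close>, so the coefficients of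
  \<open>T\<^sup>n a\<close> are \<open>l j ^ n * a j\<close> with \<open>a j = \<langle>a, e j\<rangle>\<close>.  Expanding the inner product in the basis,
  \<open>\<langle>f, T\<^sup>n a\<rangle>\<close> is the conjugate of \<open>\<Sum>j. d j * l j ^ n\<close>, where \<open>d j = cnj \<langle>f, e j\<rangle> * a j\<close>.  As
  \<open>\<bar>a j\<bar>\<^sup>2\<close> is comparable to \<open>1 - \<bar>l j\<bar>\<^sup>2\<close>, Parseval's identity makes \<open>\<parallel>f\<parallel>\<^sup>2\<close> comparable to
  \<open>\<Sum>j. \<bar>d j\<bar>\<^sup>2 / (1 - \<bar>l j\<bar>\<^sup>2)\<close>.  The frame inequalities therefore say that
  \<open>\<Sum>n. \<bar>\<Sum>j. d j * l j ^ n\<bar>\<^sup>2\<close> is comparable to \<open>\<Sum>j. \<bar>d j\<bar>\<^sup>2 / (1 - \<bar>l j\<bar>\<^sup>2)\<close>: the sequences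
  \<open>(l j ^ n)\<^sub>n\<close>, which are Szego kernels of the Hardy space, form a Riesz sequence once they are
  normalized.

  Both Riesz bounds follow from bounded interpolation in the disc.  If \<open>F\<close> is holomorphic near the
  closed disc and bounded by \<open>M\<close> on the circle, then replacing \<open>d j\<close> by \<open>F (l j) * d j\<close> applies the
  backward Toeplitz operator with symbol \<open>F\<close> to the sequence \<open>\<Sum>j. d j * l j ^ n\<close>, and this operator
  has norm at most \<open>M\<close> (\<open>multiplier_le\<close>).  For finitely many nodes with separation constant \<open>\<delta>\<close>,
  Peter Jones's explicit functions give an \<open>F\<close> with prescribed values \<open>F (l j)\<close> in the closed unit disc and
  with \<open>M = exp 2 / \<delta> ^ 5\<close>, whatever the number of nodes (\<open>interpolation\<close>).  Hence unimodular changes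
  of the coefficients change the norm by at most a factor \<open>M\<close> in either direction.  Averaging over
  unimodular coefficients cancels all cross terms and leaves the sum of the squared norms of the
  single terms, which is \<open>\<Sum>j. \<bar>d j\<bar>\<^sup>2 / (1 - \<bar>l j\<bar>\<^sup>2)\<close> (\<open>riesz_finite\<close>).  The bounds do not depend on
  the number of nodes and pass to the limit.

  Parseval's identity needs the completeness of the exponentials on the interval \<open>\<Omega>\<close>
  (\<open>exp_basis_complete\<close>): a square-integrable function is a limit of bounded ones, a bounded one is an
  almost everywhere limit of bounded continuous functions on the circle, and those are uniform
  limits of trigonometric polynomials by the Stone--Weierstrass theorem.
\<close>

section \<open>Polynomial multipliers and backward Toeplitz operators\<close>

text \<open>The unitarity of the discrete Fourier transform.  It serves twice: as Parseval's identity for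
  polynomials, with values at the roots of unity in place of an integral over the circle, and as the
  averaging argument over unimodular coefficients.\<close>

lemma roots_of_unity_parseval:
  fixes x :: "nat \<Rightarrow> complex"
  assumes "L > 0"
  defines "\<zeta> \<equiv> cis (2 * pi / real L)"
  shows "(\<Sum>k<L. (cmod (\<Sum>j<L. x j * \<zeta> ^ (j * k)))\<^sup>2) = real L * (\<Sum>j<L. (cmod (x j))\<^sup>2)"
proof -
  have \<zeta>_pow: "\<zeta> ^ k = cis (2 * pi * real k / real L)" for k
  proof -
    have "\<zeta> ^ k = cis (real k * (2 * pi / real L))" unfolding \<zeta>_def by (rule Complex.DeMoivre)
    also have "real k * (2 * pi / real L) = 2 * pi * real k / real L" by simp
    finally show ?thesis .
  qed
  have unit: "\<zeta> ^ j * cnj (\<zeta> ^ j) = 1" for j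
    unfolding \<zeta>_pow by (simp add: cis_cnj cis_mult)
  have geom: "(\<Sum>k<L. (\<zeta> ^ i * cnj (\<zeta> ^ j)) ^ k) = (if i = j then of_nat L else 0)"
    if "i < L" "j < L" for i j
  proof (cases "i = j")
    case True
    then show ?thesis using unit by simp
  next
    case False
    let ?r = "\<zeta> ^ i * cnj (\<zeta> ^ j)"
    have "\<zeta> ^ i \<noteq> \<zeta> ^ j"
      using Complex.bij_betw_roots_unity[OF assms(1)] that False
      unfolding \<zeta>_pow bij_betw_def inj_on_def by blast
    have "?r \<noteq> 1"
    proof
      assume "?r = 1"
      then have "\<zeta> ^ i * (\<zeta> ^ j * cnj (\<zeta> ^ j)) = \<zeta> ^ j"
        by (simp add: mult_ac)
      with unit \<open>\<zeta> ^ i \<noteq> \<zeta> ^ j\<close> show False by simp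
    qed
    have "\<zeta> ^ L = 1" unfolding \<zeta>_pow using assms(1) by simp
    then have "?r ^ L = 1"
      by (metis complex_cnj_one complex_cnj_power mult_1 power_commutes power_mult power_mult_distrib power_one mult.commute)
    then show ?thesis using False \<open>?r \<noteq> 1\<close> by (simp add: geometric_sum)
  qed
  have "complex_of_real (\<Sum>k<L. (cmod (\<Sum>j<L. x j * \<zeta> ^ (j * k)))\<^sup>2)
      = (\<Sum>k<L. \<Sum>i<L. \<Sum>j<L. x i * cnj (x j) * (\<zeta> ^ i * cnj (\<zeta> ^ j)) ^ k)"
    by (simp add: complex_norm_square sum_product power_mult_distrib mult_ac
        flip: power_mult of_real_power)
  also have "\<dots> = (\<Sum>i<L. \<Sum>j<L. x i * cnj (x j) * (\<Sum>k<L. (\<zeta> ^ i * cnj (\<zeta> ^ j)) ^ k))"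
    unfolding sum_distrib_left
    by (rule trans[OF sum.swap], rule sum.cong[OF refl], rule sum.swap)
  also have "\<dots> = (\<Sum>i<L. \<Sum>j<L. x i * cnj (x j) * (if i = j then of_nat L else 0))"
    by (intro sum.cong refl arg_cong[of _ _ "(*) _"] geom) auto
  also have "\<dots> = (\<Sum>i<L. of_nat L * (x i * cnj (x i)))"
    by (intro sum.cong refl) (simp add: if_distrib cong: if_cong)
  also have "\<dots> = complex_of_real (real L * (\<Sum>j<L. (cmod (x j))\<^sup>2))"
    by (simp add: complex_norm_square sum_distrib_left del: of_real_power)
  finally show ?thesis by (simp only: of_real_eq_iff)
qed

text \<open>Multiplication by a polynomial bounded by \<open>M\<close> on the circle has norm at most \<open>M\<close> on the Hardy
  space: \<open>L\<close> exceeds the degree of the product, so the values at the \<open>L\<close>-th roots of unity compute both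
  norms.\<close>

lemma sum_coeff_mult_le:
  fixes p q :: "complex poly"
  assumes bound: "\<And>z. cmod z = 1 \<Longrightarrow> cmod (poly p z) \<le> M"
    and L: "degree p + degree q < L"
  shows "(\<Sum>n<L. (cmod (coeff (p * q) n))\<^sup>2) \<le> M\<^sup>2 * (\<Sum>n<L. (cmod (coeff q n))\<^sup>2)"
proof -
  define \<zeta> where "\<zeta> = cis (2 * pi / real L)"
  have L0: "L > 0" using L by simp
  have val: "(\<Sum>k<L. (cmod (poly r (\<zeta> ^ k)))\<^sup>2) = real L * (\<Sum>n<L. (cmod (coeff r n))\<^sup>2)"
    if "degree r < L" for r :: "complex poly"
  proof -
    have "poly r z = (\<Sum>j<L. coeff r j * z ^ j)" for z
      unfolding poly_altdef using that
      by (intro sum.mono_neutral_left) (auto simp: coeff_eq_0)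
    then show ?thesis
      using roots_of_unity_parseval[OF L0, of "coeff r"]
      by (simp add: \<zeta>_def power_mult[symmetric] mult.commute)
  qed
  have "real L * (\<Sum>n<L. (cmod (coeff (p * q) n))\<^sup>2) = (\<Sum>k<L. (cmod (poly (p * q) (\<zeta> ^ k)))\<^sup>2)"
    using val[of "p * q"] degree_mult_le[of p q] L by simp
  also have "\<dots> \<le> (\<Sum>k<L. M\<^sup>2 * (cmod (poly q (\<zeta> ^ k)))\<^sup>2)"
  proof (intro sum_mono)
    fix k
    have "cmod (poly p (\<zeta> ^ k)) \<le> M" by (intro bound) (simp add: \<zeta>_def norm_power)
    then show "(cmod (poly (p * q) (\<zeta> ^ k)))\<^sup>2 \<le> M\<^sup>2 * (cmod (poly q (\<zeta> ^ k)))\<^sup>2"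
      by (auto simp: norm_mult power_mult_distrib intro!: mult_right_mono power_mono)
  qed
  also have "\<dots> = real L * (M\<^sup>2 * (\<Sum>n<L. (cmod (coeff q n))\<^sup>2))"
    using val[of q] L by (simp add: sum_distrib_left[symmetric] mult_ac)
  finally show ?thesis using L0 by simp
qed

text \<open>The adjoint statement, obtained by duality.  Pairing the first \<open>K\<close> terms of the image of \<open>v\<close>
  with themselves moves the symbol onto the polynomial \<open>q\<close> with the conjugated terms as coefficients,
  where the previous bound applies after the Cauchy--Schwarz inequality.\<close>

lemma backward_toeplitz_le:
  fixes p :: "complex poly" and v :: "nat \<Rightarrow> complex"
  assumes bound: "\<And>z. cmod z = 1 \<Longrightarrow> cmod (poly p z) \<le> M"
    and v: "summable (\<lambda>n. (cmod (v n))\<^sup>2)"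
  shows "(\<Sum>n<K. (cmod (\<Sum>m\<le>degree p. coeff p m * v (n + m)))\<^sup>2) \<le> M\<^sup>2 * (\<Sum>n. (cmod (v n))\<^sup>2)"
proof (cases "K = 0")
  case True
  then show ?thesis using suminf_nonneg[OF v] by simp
next
  case False
  define w where "w n = (\<Sum>m\<le>degree p. coeff p m * v (n + m))" for n
  define q where "q = (\<Sum>n<K. monom (cnj (w n)) n)"
  have q: "coeff q n = (if n < K then cnj (w n) else 0)" for n
    unfolding q_def coeff_sum by (simp add: sum.delta)
  define L where "L = K + degree p"
  have degq: "degree q < K" using False by (intro degree_lessI) (auto simp: q)
  define W where "W = (\<Sum>n<K. (cmod (w n))\<^sup>2)"
  have Wq: "(\<Sum>n<L. (cmod (coeff q n))\<^sup>2) = W"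
    unfolding W_def by (rule sum.mono_neutral_cong_right) (auto simp: q L_def)
  have W0: "W \<ge> 0" unfolding W_def by (intro sum_nonneg) auto
  have "complex_of_real W = (\<Sum>n<K. w n * coeff q n)"
    unfolding W_def by (simp add: q complex_norm_square del: of_real_power)
  also have "\<dots> = (\<Sum>n<K. \<Sum>m\<le>degree p. v (n + m) * (coeff p m * coeff q n))"
    by (simp add: w_def sum_distrib_left mult_ac)
  also have "\<dots> = (\<Sum>(n, m)\<in>{..<K} \<times> {..degree p}. v (n + m) * (coeff p m * coeff q n))"
    by (simp add: sum.cartesian_product)
  \<comment> \<open>Reindexing by \<open>i = n + m\<close> collects the coefficients of \<open>p * q\<close>; the additional pairs
      contribute \<open>0\<close>.\<close>
  also have "\<dots> = (\<Sum>(i, m)\<in>(SIGMA i:{..<L}. {..i}). v i * (coeff p m * coeff q (i - m)))"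
  proof (rule sum.reindex_bij_witness_not_neutral
      [where S' = "{}" and T' = "{(i, m)\<in>(SIGMA i:{..<L}. {..i}). m > degree p \<or> i - m \<ge> K}"
         and i = "\<lambda>(i, m). (i - m, m)" and j = "\<lambda>(n, m). (n + m, m)"])
    show "finite {(i, m)\<in>(SIGMA i:{..<L}. {..i}). m > degree p \<or> i - m \<ge> K}"
      by (rule finite_subset[of _ "SIGMA i:{..<L}. {..i}"]) auto
  qed (auto simp: L_def q coeff_eq_0)
  also have "\<dots> = (\<Sum>i<L. v i * coeff (p * q) i)"
    by (simp add: sum.Sigma[symmetric] coeff_mult sum_distrib_left)
  finally have "W = cmod (\<Sum>i<L. v i * coeff (p * q) i)"
    by (metis W0 abs_of_nonneg norm_of_real)
  also have "\<dots> \<le> (\<Sum>i<L. cmod (v i) * cmod (coeff (p * q) i))"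
    by (rule order_trans[OF norm_sum]) (simp add: norm_mult)
  finally have "W\<^sup>2 \<le> (\<Sum>i<L. cmod (v i) * cmod (coeff (p * q) i))\<^sup>2"
    using W0 by (intro power_mono)
  also have "\<dots> \<le> (\<Sum>i<L. (cmod (v i))\<^sup>2) * (\<Sum>i<L. (cmod (coeff (p * q) i))\<^sup>2)"
    by (rule Cauchy_Schwarz_ineq_sum)
  also have "\<dots> \<le> (\<Sum>n. (cmod (v n))\<^sup>2) * (M\<^sup>2 * W)"
    using sum_coeff_mult_le[OF bound, of q L] degq Wq
    by (intro mult_mono sum_le_suminf v sum_nonneg suminf_nonneg) (auto simp: L_def)
  finally have "W * W \<le> (M\<^sup>2 * (\<Sum>n. (cmod (v n))\<^sup>2)) * W"
    by (simp add: power2_eq_square mult_ac)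
  then have "W \<le> M\<^sup>2 * (\<Sum>n. (cmod (v n))\<^sup>2)"
  proof (cases "W = 0")
    case True
    then show ?thesis using suminf_nonneg[OF v] by simp
  qed (use W0 in auto)
  then show ?thesis unfolding W_def w_def .
qed

section \<open>Jones's interpolating functions\<close>

text \<open>A Riemann sum for the integral of \<open>exp (- t)\<close> over \<open>[0, \<infinity>)\<close>, the points being added in the order of
  their rank \<open>r\<close>.  A new point \<open>m\<close> of maximal rank enters every exponent, so the old sum is multiplied
  by \<open>exp (- x m)\<close>, and \<open>(1 + x m) * exp (- x m) \<le> 1\<close>.  Ties in rank only enlarge the sums
  in the exponents.\<close>

lemma sum_mult_exp_tail_le_1:
  fixes x :: "'a \<Rightarrow> real" and r :: "'a \<Rightarrow> real"
  assumes "finite S" and "\<And>k. k \<in> S \<Longrightarrow> x k \<ge> 0"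
  shows "(\<Sum>j\<in>S. x j * exp (- (\<Sum>k\<in>{k\<in>S. r j \<le> r k}. x k))) \<le> 1"
  using assms
proof (induction rule: finite_ranking_induct[where f = r])
  case empty
  then show ?case by simp
next
  case (insert m S)
  show ?case
  proof (cases "m \<in> S")
    case True
    then show ?thesis using insert by (simp add: insert_absorb)
  next
    case False
    have nn: "x m \<ge> 0" "\<And>k. k \<in> S \<Longrightarrow> x k \<ge> 0" using insert by auto
    have split: "(\<Sum>k\<in>{k\<in>insert m S. r j \<le> r k}. x k) = x m + (\<Sum>k\<in>{k\<in>S. r j \<le> r k}. x k)"
      if "j \<in> S" for j
    proof -
      have "{k\<in>insert m S. r j \<le> r k} = insert m {k\<in>S. r j \<le> r k}"
        using that insert by auto
      then show ?thesis using False insert by simp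
    qed
    have "x m \<le> (\<Sum>k\<in>{k\<in>insert m S. r m \<le> r k}. x k)"
      using insert by (intro member_le_sum) auto
    then have top: "x m * exp (- (\<Sum>k\<in>{k\<in>insert m S. r m \<le> r k}. x k)) \<le> x m * exp (- x m)"
      using nn by (intro mult_left_mono) auto
    have "(\<Sum>j\<in>insert m S. x j * exp (- (\<Sum>k\<in>{k\<in>insert m S. r j \<le> r k}. x k)))
        = x m * exp (- (\<Sum>k\<in>{k\<in>insert m S. r m \<le> r k}. x k))
          + (\<Sum>j\<in>S. x j * exp (- (\<Sum>k\<in>{k\<in>insert m S. r j \<le> r k}. x k)))"
      using insert(1) False by (rule sum.insert)
    also have "(\<Sum>j\<in>S. x j * exp (- (\<Sum>k\<in>{k\<in>insert m S. r j \<le> r k}. x k)))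
        = (\<Sum>j\<in>S. x j * exp (- (x m + (\<Sum>k\<in>{k\<in>S. r j \<le> r k}. x k))))"
      by (intro sum.cong refl) (simp only: split)
    also have "x m * exp (- (\<Sum>k\<in>{k\<in>insert m S. r m \<le> r k}. x k))
          + (\<Sum>j\<in>S. x j * exp (- (x m + (\<Sum>k\<in>{k\<in>S. r j \<le> r k}. x k))))
        \<le> x m * exp (- x m) + (\<Sum>j\<in>S. x j * exp (- (x m + (\<Sum>k\<in>{k\<in>S. r j \<le> r k}. x k))))"
      using top by (rule add_right_mono)
    also have "\<dots> = exp (- x m) * (x m + (\<Sum>j\<in>S. x j * exp (- (\<Sum>k\<in>{k\<in>S. r j \<le> r k}. x k))))"
      by (simp add: exp_add exp_minus exp_diff sum_distrib_left algebra_simps divide_inverse)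
    also have "\<dots> \<le> exp (- x m) * (x m + 1)"
      using insert nn by (intro mult_left_mono add_left_mono) auto
    also have "\<dots> \<le> exp (- x m) * exp (x m)"
      using exp_ge_add_one_self[of "x m"] by (intro mult_left_mono) (auto simp: add.commute)
    also have "\<dots> = 1" by (simp add: exp_minus)
    finally show ?thesis .
  qed
qed



text \<open>The pseudohyperbolic distance of the unit disc.\<close>

definition pseudo_dist :: "complex \<Rightarrow> complex \<Rightarrow> real" where
  "pseudo_dist a b = cmod ((a - b) / (1 - cnj b * a))"

text \<open>Jones's function attached to the node \<open>l j\<close> of the finite family indexed by \<open>S\<close>.  The Blaschke
  quotient gives the values \<open>0\<close> at the other nodes and \<open>1\<close> at \<open>l j\<close>.  On the circle the square has modulus
  \<open>(1 - \<bar>l j\<bar>\<^sup>2)\<^sup>2 / \<bar>1 - cnj (l j) * z\<bar>\<^sup>2\<close>, and the exponential adds exactly the decay, in terms of the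
  same quantities for the nodes at least as close to the circle as \<open>l j\<close>, that makes the sum over \<open>j\<close>
  bounded.\<close>

definition jones :: "nat set \<Rightarrow> (nat \<Rightarrow> complex) \<Rightarrow> nat \<Rightarrow> complex \<Rightarrow> complex" where
  "jones S l j z =
     (\<Prod>k\<in>S - {j}. ((z - l k) / (1 - cnj (l k) * z)) / ((l j - l k) / (1 - cnj (l k) * l j)))
     * (of_real (1 - (cmod (l j))\<^sup>2) / (1 - cnj (l j) * z)) ^ 2
     * exp (\<Sum>k\<in>{k\<in>S. cmod (l j) \<le> cmod (l k)}. of_real (1 - (cmod (l k))\<^sup>2) *
         ((1 + cnj (l k) * l j) / (1 - cnj (l k) * l j) - (1 + cnj (l k) * z) / (1 - cnj (l k) * z)))"

lemma one_minus_cnj_mult_nonzero: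
  fixes a z :: complex
  assumes "cmod a * cmod z < 1"
  shows "1 - cnj a * z \<noteq> 0"
proof
  assume "1 - cnj a * z = 0"
  then have "cnj a * z = 1" by simp
  then have "cmod (cnj a * z) = 1" by simp
  with assms show False by (simp add: norm_mult)
qed

text \<open>The identity behind both the modulus \<open>1\<close> of Blaschke factors on the circle and the formula for
  \<open>1 - (pseudo_dist a b)\<^sup>2\<close>.\<close>

lemma cmod_one_minus_cnj_mult_sq:
  fixes a z :: complex
  shows "(cmod (1 - cnj a * z))\<^sup>2 = (cmod (z - a))\<^sup>2 + (1 - (cmod a)\<^sup>2) * (1 - (cmod z)\<^sup>2)"
  unfolding cmod_power2 by (simp add: power2_eq_square algebra_simps)

text \<open>On the circle this is the Poisson kernel, which gives the modulus of the exponential factor of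
  \<open>jones\<close>.\<close>

lemma Re_herglotz_kernel:
  fixes a z :: complex
  shows "Re ((1 + cnj a * z) / (1 - cnj a * z)) = (1 - (cmod a)\<^sup>2 * (cmod z)\<^sup>2) / (cmod (1 - cnj a * z))\<^sup>2"
proof -
  have "Re ((1 + cnj a * z) * cnj (1 - cnj a * z)) = 1 - (cmod a)\<^sup>2 * (cmod z)\<^sup>2"
    unfolding cmod_power2 by (simp add: power2_eq_square algebra_simps)
  then show ?thesis
    by (subst complex_div_cnj) (simp add: Re_divide_of_real flip: of_real_power)
qed

lemma one_minus_pseudo_dist_sq:
  fixes a b :: complex
  assumes "cmod a < 1" "cmod b < 1"
  shows "1 - (pseudo_dist a b)\<^sup>2 = (1 - (cmod a)\<^sup>2) * (1 - (cmod b)\<^sup>2) / (cmod (1 - cnj b * a))\<^sup>2"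
proof -
  have "cmod b * cmod a < 1" using assms
    by (metis mult_less_cancel_left2 norm_ge_zero order_le_less_trans mult.commute mult_left_le less_eq_real_def)
  then have "(cmod (1 - cnj b * a))\<^sup>2 \<noteq> 0" using one_minus_cnj_mult_nonzero[of b a] by simp
  then show ?thesis
    using cmod_one_minus_cnj_mult_sq[of b a]
    by (simp add: pseudo_dist_def norm_divide power_divide field_simps)
qed

lemma cmod_sq_less_1: "cmod a < 1 \<Longrightarrow> (cmod a)\<^sup>2 < 1"
  by (simp add: power_less_one_iff abs_square_less_1)

context
  fixes S :: "nat set" and l :: "nat \<Rightarrow> complex" and \<delta> :: real
  assumes fin: "finite S"
    and disc: "\<And>j. j \<in> S \<Longrightarrow> cmod (l j) < 1"
    and sep: "\<And>j. j \<in> S \<Longrightarrow> \<delta> \<le> (\<Prod>k\<in>S - {j}. pseudo_dist (l j) (l k))"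
    and \<delta>: "0 < \<delta>"
begin

lemma pseudo_dist_pos:
  assumes "j \<in> S" "k \<in> S" "k \<noteq> j"
  shows "pseudo_dist (l j) (l k) > 0"
proof -
  have "pseudo_dist (l j) (l k) \<noteq> 0"
  proof
    assume "pseudo_dist (l j) (l k) = 0"
    then have "(\<Prod>k\<in>S - {j}. pseudo_dist (l j) (l k)) = 0"
      using assms fin by (intro prod_zero) auto
    then show False using sep[OF assms(1)] \<delta> by simp
  qed
  then show ?thesis unfolding pseudo_dist_def by (metis norm_ge_zero order_le_less)
qed

lemma denom_nonzero:
  assumes "k \<in> S" "cmod z \<le> 1"
  shows "1 - cnj (l k) * z \<noteq> 0"
proof (rule one_minus_cnj_mult_nonzero)
  have "cmod (l k) * cmod z \<le> cmod (l k)" using assms by (simp add: mult_left_le)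
  then show "cmod (l k) * cmod z < 1" using disc[OF assms(1)] by simp
qed

text \<open>Separation implies the Carleson condition tested at the nodes: each term with \<open>k \<noteq> j\<close> is
  \<open>1 - (pseudo_dist (l j) (l k))\<^sup>2\<close>, and \<open>t \<le> exp (t - 1)\<close> turns the product of the squared distances,
  which is at least \<open>\<delta>\<^sup>2\<close>, into the exponential of minus the sum.  The term \<open>k = j\<close> equals \<open>1\<close>.\<close>

lemma carleson_test_exp_le:
  assumes j: "j \<in> S"
  shows "exp (\<Sum>k\<in>S. (1 - (cmod (l j))\<^sup>2) * (1 - (cmod (l k))\<^sup>2) / (cmod (1 - cnj (l k) * l j))\<^sup>2)
         \<le> exp 1 / \<delta>\<^sup>2"
proof -
  let ?t = "\<lambda>k. (1 - (cmod (l j))\<^sup>2) * (1 - (cmod (l k))\<^sup>2) / (cmod (1 - cnj (l k) * l j))\<^sup>2"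
  have tj: "?t j = 1"
    using one_minus_pseudo_dist_sq[OF disc[OF j] disc[OF j]] cmod_sq_less_1[OF disc[OF j]]
    by (simp add: pseudo_dist_def)
  have "\<delta>\<^sup>2 \<le> (\<Prod>k\<in>S - {j}. pseudo_dist (l j) (l k))\<^sup>2"
    using sep[OF j] \<delta> by (intro power_mono) auto
  also have "\<dots> = (\<Prod>k\<in>S - {j}. (pseudo_dist (l j) (l k))\<^sup>2)"
    by (simp add: prod_power_distrib)
  also have "\<dots> \<le> (\<Prod>k\<in>S - {j}. exp (- ?t k))"
  proof (intro prod_mono conjI)
    fix k assume k: "k \<in> S - {j}"
    have "1 + (- ?t k) \<le> exp (- ?t k)" by (rule exp_ge_add_one_self)
    then show "(pseudo_dist (l j) (l k))\<^sup>2 \<le> exp (- ?t k)"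
      using one_minus_pseudo_dist_sq[OF disc[OF j] disc[of k]] k by simp
  qed auto
  also have "\<dots> = exp (- (\<Sum>k\<in>S - {j}. ?t k))"
    using fin by (simp add: exp_sum[symmetric] sum_negf)
  finally have "exp (\<Sum>k\<in>S - {j}. ?t k) \<le> 1 / \<delta>\<^sup>2"
    using \<delta> by (simp add: exp_minus field_simps)
  moreover have "(\<Sum>k\<in>S. ?t k) = 1 + (\<Sum>k\<in>S - {j}. ?t k)"
    using sum.remove[OF fin j, of ?t] tj by simp
  ultimately show ?thesis by (simp add: exp_add divide_inverse)
qed

lemma jones_at_nodes:
  assumes "j \<in> S" "i \<in> S"
  shows "jones S l j (l i) = (if i = j then 1 else 0)"
proof (cases "i = j")
  case True
  have 1: "((l j - l k) / (1 - cnj (l k) * l j)) / ((l j - l k) / (1 - cnj (l k) * l j)) = 1"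
    if "k \<in> S - {j}" for k
    using pseudo_dist_pos[OF assms(1), of k] that by (auto simp: pseudo_dist_def)
  have 2: "of_real (1 - (cmod (l j))\<^sup>2) = 1 - cnj (l j) * l j"
    by (simp add: complex_norm_square mult.commute del: of_real_power)
  have 3: "1 - cnj (l j) * l j \<noteq> 0" using denom_nonzero[OF assms(1), of "l j"] disc[OF assms(1)] by simp
  have "(\<Prod>k\<in>S - {j}. ((l j - l k) / (1 - cnj (l k) * l j)) / ((l j - l k) / (1 - cnj (l k) * l j))) = 1"
    by (intro prod.neutral ballI 1)
  moreover have "of_real (1 - (cmod (l j))\<^sup>2) / (1 - cnj (l j) * l j) = 1"
    unfolding 2 using 3 by (rule divide_self)
  ultimately show ?thesis using True by (simp only: jones_def) simp
next
  case False
  have "(\<Prod>k\<in>S - {j}. ((l i - l k) / (1 - cnj (l k) * l i)) / ((l j - l k) / (1 - cnj (l k) * l j))) = 0"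
    using assms False fin by (intro prod_zero) auto
  then show ?thesis using False unfolding jones_def by simp
qed

lemma jones_holomorphic:
  assumes "\<And>k z. k \<in> S \<Longrightarrow> z \<in> A \<Longrightarrow> 1 - cnj (l k) * z \<noteq> 0" and j: "j \<in> S"
  shows "jones S l j holomorphic_on A"
  unfolding jones_def[abs_def]
  using assms pseudo_dist_pos[OF j]
  by (intro holomorphic_intros) (auto simp: pseudo_dist_def)

text \<open>The Blaschke quotient costs a factor \<open>1 / \<delta>\<close> and the exponential one a factor \<open>exp 2 / \<delta> ^ 4\<close>:
  for the nodes \<open>k\<close> with \<open>\<bar>l j\<bar> \<le> \<bar>l k\<bar>\<close> the weighted real part of the kernel at \<open>l j\<close> is at most twice the
  corresponding term of the Carleson test, because \<open>1 - \<bar>l k\<bar>\<^sup>2 \<bar>l j\<bar>\<^sup>2 \<le> 2 (1 - \<bar>l j\<bar>\<^sup>2)\<close>.\<close>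

lemma norm_jones_le:
  assumes j: "j \<in> S" and z: "cmod z = 1"
  defines "x \<equiv> \<lambda>k. (1 - (cmod (l k))\<^sup>2)\<^sup>2 / (cmod (1 - cnj (l k) * z))\<^sup>2"
  shows "cmod (jones S l j z)
    \<le> exp 2 / \<delta> ^ 5 * (x j * exp (- (\<Sum>k\<in>{k\<in>S. cmod (l j) \<le> cmod (l k)}. x k)))"
proof -
  let ?U = "{k\<in>S. cmod (l j) \<le> cmod (l k)}"
  let ?w = "\<lambda>k. 1 - (cmod (l k))\<^sup>2"
  let ?t = "\<lambda>k. ?w j * ?w k / (cmod (1 - cnj (l k) * l j))\<^sup>2"
  have w0: "?w k > 0" if "k \<in> S" for k using cmod_sq_less_1[OF disc[OF that]] by simp
  have blaschke: "cmod (\<Prod>k\<in>S - {j}. ((z - l k) / (1 - cnj (l k) * z)) / ((l j - l k) / (1 - cnj (l k) * l j)))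
      \<le> 1 / \<delta>"
  proof -
    have one: "cmod ((z - l k) / (1 - cnj (l k) * z)) = 1" if "k \<in> S" for k
    proof -
      have "(cmod (1 - cnj (l k) * z))\<^sup>2 = (cmod (z - l k))\<^sup>2"
        using cmod_one_minus_cnj_mult_sq[of "l k" z] z by simp
      then have "cmod (z - l k) = cmod (1 - cnj (l k) * z)" by simp
      moreover have "cmod (1 - cnj (l k) * z) \<noteq> 0" using denom_nonzero[OF that, of z] z by simp
      ultimately show ?thesis unfolding norm_divide by simp
    qed
    have "cmod (\<Prod>k\<in>S - {j}. ((z - l k) / (1 - cnj (l k) * z)) / ((l j - l k) / (1 - cnj (l k) * l j)))
      = (\<Prod>k\<in>S - {j}. 1 / pseudo_dist (l j) (l k))"
      unfolding prod_norm[symmetric] pseudo_dist_def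
      by (intro prod.cong refl, subst norm_divide, subst one) auto
    also have "\<dots> = 1 / (\<Prod>k\<in>S - {j}. pseudo_dist (l j) (l k))"
      by (simp add: prod_dividef)
    also have "\<dots> \<le> 1 / \<delta>" using sep[OF j] \<delta> by (intro divide_left_mono) (auto intro!: mult_pos_pos)
    finally show ?thesis .
  qed
  have square: "cmod ((of_real (?w j) / (1 - cnj (l j) * z)) ^ 2) = x j"
    by (simp add: x_def norm_power norm_divide power_divide del: of_real_diff)
  have expo: "cmod (exp (\<Sum>k\<in>?U. of_real (?w k) *
         ((1 + cnj (l k) * l j) / (1 - cnj (l k) * l j) - (1 + cnj (l k) * z) / (1 - cnj (l k) * z))))
       \<le> exp 2 / \<delta> ^ 4 * exp (- (\<Sum>k\<in>?U. x k))"
  proof -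
    have Re_scaled: "Re (of_real c * (u - v)) = c * (Re u - Re v)" for c and u v :: complex
      by simp
    have "Re (\<Sum>k\<in>?U. of_real (?w k) *
         ((1 + cnj (l k) * l j) / (1 - cnj (l k) * l j) - (1 + cnj (l k) * z) / (1 - cnj (l k) * z)))
       = (\<Sum>k\<in>?U. ?w k * (Re ((1 + cnj (l k) * l j) / (1 - cnj (l k) * l j)) - Re ((1 + cnj (l k) * z) / (1 - cnj (l k) * z))))"
      unfolding Re_sum by (simp only: Re_scaled)
    also have "\<dots> \<le> (\<Sum>k\<in>?U. 2 * ?t k - x k)"
    proof (intro sum_mono)
      fix k assume k: "k \<in> ?U"
      have "(cmod (l j))\<^sup>2 \<le> (cmod (l k))\<^sup>2" using k by (intro power_mono) auto
      moreover have "0 \<le> ?w k * ?w j" using w0[of k] w0[OF j] k by simp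
      moreover have "1 - b * a \<le> 2 * (1 - a)" if "a \<le> b" "0 \<le> (1 - b) * (1 - a)" for a b :: real
        using that by (simp add: algebra_simps)
      ultimately have "1 - (cmod (l k))\<^sup>2 * (cmod (l j))\<^sup>2 \<le> 2 * ?w j" by blast
      then have "?w k * ((1 - (cmod (l k))\<^sup>2 * (cmod (l j))\<^sup>2) / (cmod (1 - cnj (l k) * l j))\<^sup>2)
          \<le> ?w k * (2 * ?w j / (cmod (1 - cnj (l k) * l j))\<^sup>2)"
        using w0[of k] k by (intro mult_left_mono divide_right_mono) auto
      then show "?w k * (Re ((1 + cnj (l k) * l j) / (1 - cnj (l k) * l j)) - Re ((1 + cnj (l k) * z) / (1 - cnj (l k) * z)))
          \<le> 2 * ?t k - x k"
        unfolding Re_herglotz_kernel z x_def by (simp add: power2_eq_square algebra_simps)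
    qed
    also have "\<dots> = 2 * (\<Sum>k\<in>?U. ?t k) - (\<Sum>k\<in>?U. x k)"
      by (simp add: sum_subtractf sum_distrib_left)
    also have "\<dots> \<le> 2 * (\<Sum>k\<in>S. ?t k) - (\<Sum>k\<in>?U. x k)"
    proof -
      have "(\<Sum>k\<in>?U. ?t k) \<le> (\<Sum>k\<in>S. ?t k)"
        using fin w0 j by (intro sum_mono2) (auto intro!: divide_nonneg_nonneg mult_nonneg_nonneg simp: less_imp_le)
      then show ?thesis by simp
    qed
    finally have "Re (\<Sum>k\<in>?U. of_real (?w k) *
         ((1 + cnj (l k) * l j) / (1 - cnj (l k) * l j) - (1 + cnj (l k) * z) / (1 - cnj (l k) * z)))
       \<le> 2 * (\<Sum>k\<in>S. ?t k) - (\<Sum>k\<in>?U. x k)" .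
    then have "cmod (exp (\<Sum>k\<in>?U. of_real (?w k) *
         ((1 + cnj (l k) * l j) / (1 - cnj (l k) * l j) - (1 + cnj (l k) * z) / (1 - cnj (l k) * z))))
       \<le> exp (2 * (\<Sum>k\<in>S. ?t k) - (\<Sum>k\<in>?U. x k))"
      unfolding norm_exp_eq_Re by (simp only: exp_le_cancel_iff)
    also have "\<dots> = (exp (\<Sum>k\<in>S. ?t k))\<^sup>2 * exp (- (\<Sum>k\<in>?U. x k))"
      by (simp add: exp_diff exp_minus exp_double divide_inverse)
    also have "\<dots> \<le> (exp 1 / \<delta>\<^sup>2)\<^sup>2 * exp (- (\<Sum>k\<in>?U. x k))"
      using carleson_test_exp_le[OF j] by (intro mult_right_mono power_mono) auto
    also have "(exp 1 / \<delta>\<^sup>2)\<^sup>2 = exp 2 / \<delta> ^ 4"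
      by (simp add: power_divide exp_double[symmetric] flip: power_mult)
    finally show ?thesis .
  qed
  have x0: "x j \<ge> 0" by (simp add: x_def)
  have "cmod (jones S l j z) \<le> 1 / \<delta> * x j * (exp 2 / \<delta> ^ 4 * exp (- (\<Sum>k\<in>?U. x k)))"
    unfolding jones_def norm_mult square
    using blaschke expo x0 \<delta> by (intro mult_mono) auto
  also have "\<dots> = exp 2 / \<delta> ^ 5 * (x j * exp (- (\<Sum>k\<in>?U. x k)))"
    using \<delta> by (simp add: field_simps power_numeral_reduce)
  finally show ?thesis .
qed

text \<open>Carleson's interpolation theorem for a finite set of nodes, with a bound that depends on the
  separation constant alone.\<close>

lemma interpolation:
  assumes \<epsilon>: "\<And>j. j \<in> S \<Longrightarrow> cmod (\<epsilon> j) \<le> 1"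
  obtains F R where "R > 1" "F holomorphic_on ball 0 R" "\<And>j. j \<in> S \<Longrightarrow> F (l j) = \<epsilon> j"
    "\<And>z. cmod z = 1 \<Longrightarrow> cmod (F z) \<le> exp 2 / \<delta> ^ 5"
proof -
  \<comment> \<open>The poles lie outside the disc of radius \<open>1 / q\<close>; the value \<open>1/2\<close> only
      guards against \<open>q = 0\<close>.\<close>
  define q where "q = Max (insert (1/2) ((\<lambda>k. cmod (l k)) ` S))"
  have q_ge: "x \<le> q" if "x \<in> insert (1/2) ((\<lambda>k. cmod (l k)) ` S)" for x
    unfolding q_def using fin that by (intro Max_ge) auto
  have q: "1/2 \<le> q" "\<And>k. k \<in> S \<Longrightarrow> cmod (l k) \<le> q"
    using q_ge[of "1/2"] q_ge by auto
  have q1: "q < 1" unfolding q_def using fin disc by (subst Max_less_iff) auto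
  define F where "F z = (\<Sum>j\<in>S. \<epsilon> j * jones S l j z)" for z
  have den: "1 - cnj (l k) * z \<noteq> 0" if "k \<in> S" "z \<in> ball 0 (1/q)" for k z
  proof (rule one_minus_cnj_mult_nonzero)
    have "cmod (l k) * cmod z \<le> q * cmod z" using q(2)[OF that(1)] by (intro mult_right_mono) auto
    also have "\<dots> < 1" using that(2) q by (simp add: field_simps)
    finally show "cmod (l k) * cmod z < 1" .
  qed
  show thesis
  proof
    show "1 / q > 1" using q q1 by simp
    show "F holomorphic_on ball 0 (1 / q)"
      unfolding F_def[abs_def] using den by (intro holomorphic_intros jones_holomorphic)
    show "F (l i) = \<epsilon> i" if "i \<in> S" for i
      using that fin by (simp add: F_def jones_at_nodes if_distrib cong: if_cong)
    show "cmod (F z) \<le> exp 2 / \<delta> ^ 5" if z: "cmod z = 1" for z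
    proof -
      let ?x = "\<lambda>k. (1 - (cmod (l k))\<^sup>2)\<^sup>2 / (cmod (1 - cnj (l k) * z))\<^sup>2"
      have "cmod (F z) \<le> (\<Sum>j\<in>S. cmod (\<epsilon> j * jones S l j z))"
        unfolding F_def by (rule norm_sum)
      also have "\<dots> \<le> (\<Sum>j\<in>S. 1 * (exp 2 / \<delta> ^ 5 *
          (?x j * exp (- (\<Sum>k\<in>{k\<in>S. cmod (l j) \<le> cmod (l k)}. ?x k)))))"
        unfolding norm_mult using \<epsilon> norm_jones_le[OF _ z] by (intro sum_mono mult_mono) auto
      also have "\<dots> = exp 2 / \<delta> ^ 5 *
          (\<Sum>j\<in>S. ?x j * exp (- (\<Sum>k\<in>{k\<in>S. cmod (l j) \<le> cmod (l k)}. ?x k)))"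
        by (simp add: sum_distrib_left)
      also have "\<dots> \<le> exp 2 / \<delta> ^ 5 * 1"
        using \<delta> by (intro mult_left_mono sum_mult_exp_tail_le_1 fin) auto
      finally show ?thesis by simp
    qed
  qed
qed

end

section \<open>Riesz bounds for Szego kernels\<close>

text \<open>Taylor polynomials converge uniformly on the closed unit disc, since the radius of convergence
  exceeds \<open>1\<close>.  This reduces bounded holomorphic multipliers to polynomial ones.\<close>

lemma holomorphic_polynomial_approx:
  assumes F: "F holomorphic_on ball 0 R" and "R > 1" and "\<eta> > 0"
  obtains p :: "complex poly" where "\<And>z. cmod z \<le> 1 \<Longrightarrow> cmod (poly p z - F z) < \<eta>"
proof -
  define a where "a n = (deriv ^^ n) F 0 / fact n" for n
  have sums: "(\<lambda>n. a n * z ^ n) sums F z" if "cmod z < R" for z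
    using holomorphic_power_series[OF F, of z] that by (simp add: a_def)
  obtain r where r: "1 < r" "r < R" using dense[OF \<open>R > 1\<close>] by blast
  have "conv_radius a \<ge> norm (complex_of_real r)"
    using sums[of "of_real r"] r by (intro conv_radius_geI) (auto simp: sums_iff)
  then have "ereal 1 < conv_radius a"
    using r less_le_trans[of "ereal 1" "ereal r"] by simp
  from powser_uniform_limit[OF this, of 0]
  have "\<forall>\<^sub>F n in sequentially. \<forall>z\<in>cball 0 1. dist (\<Sum>i<n. a i * (z - 0) ^ i) (\<Sum>i. a i * (z - 0) ^ i) < \<eta>"
    using \<open>\<eta> > 0\<close> by (rule uniform_limitD)
  then obtain n where n: "\<forall>z\<in>cball 0 1. dist (\<Sum>i<n. a i * z ^ i) (\<Sum>i. a i * z ^ i) < \<eta>"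
    by (auto simp: eventually_sequentially)
  show thesis
  proof
    fix z :: complex assume z: "cmod z \<le> 1"
    have "(\<Sum>i. a i * z ^ i) = F z" using sums[of z] z \<open>R > 1\<close> by (simp add: sums_iff)
    then show "cmod (poly (\<Sum>i<n. monom (a i) i) z - F z) < \<eta>"
      using bspec[OF n, of z] z by (simp add: poly_sum poly_monom dist_norm)
  qed
qed

lemma summable_norm_sq_geometric_sum:
  fixes l c :: "'i \<Rightarrow> complex"
  assumes "finite S" "\<And>j. j \<in> S \<Longrightarrow> cmod (l j) < 1"
  shows "summable (\<lambda>n. (cmod (\<Sum>j\<in>S. c j * l j ^ n))\<^sup>2)"
proof -
  have "complex_of_real ((cmod (\<Sum>j\<in>S. c j * l j ^ n))\<^sup>2)
      = (\<Sum>i\<in>S. \<Sum>j\<in>S. c i * cnj (c j) * (l i * cnj (l j)) ^ n)" for n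
    by (simp add: complex_norm_square sum_product power_mult_distrib mult_ac flip: of_real_power)
  moreover have "summable (\<lambda>n. \<Sum>i\<in>S. \<Sum>j\<in>S. c i * cnj (c j) * (l i * cnj (l j)) ^ n)"
  proof (intro summable_sum summable_mult summable_geometric)
    fix i j assume "i \<in> S" "j \<in> S"
    then show "norm (l i * cnj (l j)) < 1"
      using mult_strict_mono'[of "cmod (l i)" 1 "cmod (l j)" 1] assms(2) by (simp add: norm_mult)
  qed
  ultimately have "summable (\<lambda>n. complex_of_real ((cmod (\<Sum>j\<in>S. c j * l j ^ n))\<^sup>2))" by simp
  then show ?thesis by (rule summable_complex_of_real[THEN iffD1])
qed

text \<open>If \<open>F\<close> interpolates the values \<open>\<epsilon> j\<close>, then passing from the coefficients \<open>c j\<close> to \<open>\<epsilon> j * c j\<close> is the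
  action of the backward Toeplitz operator with symbol \<open>F\<close>, since the shift multiplies \<open>(l j ^ n)\<^sub>n\<close> by
  \<open>l j\<close>.\<close>

lemma multiplier_le:
  fixes l c :: "nat \<Rightarrow> complex"
  assumes fin: "finite S"
    and disc: "\<And>j. j \<in> S \<Longrightarrow> cmod (l j) < 1"
    and sep: "\<And>j. j \<in> S \<Longrightarrow> \<delta> \<le> (\<Prod>k\<in>S - {j}. pseudo_dist (l j) (l k))"
    and \<delta>: "0 < \<delta>"
    and \<epsilon>: "\<And>j. j \<in> S \<Longrightarrow> cmod (\<epsilon> j) \<le> 1"
  shows "(\<Sum>n. (cmod (\<Sum>j\<in>S. \<epsilon> j * c j * l j ^ n))\<^sup>2)
      \<le> (exp 2 / \<delta> ^ 5)\<^sup>2 * (\<Sum>n. (cmod (\<Sum>j\<in>S. c j * l j ^ n))\<^sup>2)"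
proof -
  obtain F R where F: "R > 1" "F holomorphic_on ball 0 R" "\<And>j. j \<in> S \<Longrightarrow> F (l j) = \<epsilon> j"
    "\<And>z. cmod z = 1 \<Longrightarrow> cmod (F z) \<le> exp 2 / \<delta> ^ 5"
    by (rule interpolation[of S l \<delta> \<epsilon>]) (use fin disc sep \<delta> \<epsilon> in auto)
  have "\<exists>p :: complex poly. \<forall>z. cmod z \<le> 1 \<longrightarrow> cmod (poly p z - F z) < inverse (real (Suc m))" for m
    by (rule holomorphic_polynomial_approx[OF F(2,1), of "inverse (real (Suc m))"]) auto
  then obtain p :: "nat \<Rightarrow> complex poly"
    where p: "\<And>m z. cmod z \<le> 1 \<Longrightarrow> cmod (poly (p m) z - F z) < inverse (real (Suc m))" by metis
  let ?v = "\<lambda>n. \<Sum>j\<in>S. c j * l j ^ n"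
  let ?M = "exp 2 / \<delta> ^ 5"
  have v: "summable (\<lambda>n. (cmod (?v n))\<^sup>2)"
    using fin disc by (rule summable_norm_sq_geometric_sum)
  have fin_le: "(\<Sum>n<K. (cmod (\<Sum>j\<in>S. \<epsilon> j * c j * l j ^ n))\<^sup>2) \<le> ?M\<^sup>2 * (\<Sum>n. (cmod (?v n))\<^sup>2)" for K
  proof (rule LIMSEQ_le)
    have "(\<lambda>m. poly (p m) (l j)) \<longlonglongrightarrow> \<epsilon> j" if "j \<in> S" for j
    proof (rule LIM_zero_cancel, rule Lim_null_comparison)
      show "\<forall>\<^sub>F m in sequentially. cmod (poly (p m) (l j) - \<epsilon> j) \<le> inverse (real (Suc m))"
        using p[of "l j"] disc[OF that] F(3)[OF that] by (auto intro!: always_eventually less_imp_le)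
    qed (rule LIMSEQ_inverse_real_of_nat)
    then show "(\<lambda>m. \<Sum>n<K. (cmod (\<Sum>j\<in>S. poly (p m) (l j) * c j * l j ^ n))\<^sup>2)
        \<longlonglongrightarrow> (\<Sum>n<K. (cmod (\<Sum>j\<in>S. \<epsilon> j * c j * l j ^ n))\<^sup>2)"
      by (intro tendsto_intros)
    show "(\<lambda>m. (?M + inverse (real (Suc m)))\<^sup>2 * (\<Sum>n. (cmod (?v n))\<^sup>2)) \<longlonglongrightarrow> ?M\<^sup>2 * (\<Sum>n. (cmod (?v n))\<^sup>2)"
      using LIMSEQ_inverse_real_of_nat_add[of ?M] by (intro tendsto_intros) auto
    show "\<exists>N. \<forall>m\<ge>N. (\<Sum>n<K. (cmod (\<Sum>j\<in>S. poly (p m) (l j) * c j * l j ^ n))\<^sup>2)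
        \<le> (?M + inverse (real (Suc m)))\<^sup>2 * (\<Sum>n. (cmod (?v n))\<^sup>2)"
    proof (intro exI allI impI)
      fix m
      have "(\<Sum>i\<le>degree (p m). coeff (p m) i * ?v (n + i)) = (\<Sum>j\<in>S. poly (p m) (l j) * c j * l j ^ n)" for n
        unfolding poly_altdef sum_distrib_left sum_distrib_right
        by (subst sum.swap) (simp add: power_add mult_ac)
      moreover have "cmod (poly (p m) z) \<le> ?M + inverse (real (Suc m))" if "cmod z = 1" for z
        using norm_triangle_sub[of "poly (p m) z" "F z"] p[of z m] F(4)[OF that] that by linarith
      ultimately show "(\<Sum>n<K. (cmod (\<Sum>j\<in>S. poly (p m) (l j) * c j * l j ^ n))\<^sup>2)
        \<le> (?M + inverse (real (Suc m)))\<^sup>2 * (\<Sum>n. (cmod (?v n))\<^sup>2)"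
        using backward_toeplitz_le[OF _ v, of "p m"] by simp
    qed
  qed
  then show ?thesis
    using summable_norm_sq_geometric_sum[OF fin disc, where c = "\<lambda>j. \<epsilon> j * c j"]
    by (intro suminf_le_const) auto
qed

text \<open>The squared interpolation bound.\<close>

definition riesz_const :: "real \<Rightarrow> real" where
  "riesz_const \<delta> = (exp 2 / \<delta> ^ 5)\<^sup>2"

lemma riesz_const_nonneg: "riesz_const \<delta> \<ge> 0"
  by (simp add: riesz_const_def)

text \<open>With the coefficients \<open>\<zeta> ^ (j * k)\<close>, where \<open>\<zeta>\<close> is a primitive \<open>N\<close>-th root of unity, averaging the
  squared norms over \<open>k < N\<close> gives the sum of the squared norms \<open>\<bar>c j\<bar>\<^sup>2 / (1 - \<bar>l j\<bar>\<^sup>2)\<close> of the single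
  terms.  By \<open>multiplier_le\<close>, used with \<open>\<zeta> ^ (j * k)\<close> and with its inverse, every squared norm in this
  average agrees with the original one up to the factor \<open>riesz_const \<delta>\<close>.\<close>

lemma riesz_finite:
  fixes l c :: "nat \<Rightarrow> complex"
  assumes disc: "\<And>j. cmod (l j) < 1"
    and sep: "\<And>j. j < N \<Longrightarrow> \<delta> \<le> (\<Prod>k\<in>{..<N} - {j}. pseudo_dist (l j) (l k))"
    and \<delta>: "0 < \<delta>"
  shows "(\<Sum>n. (cmod (\<Sum>j<N. c j * l j ^ n))\<^sup>2)
           \<le> riesz_const \<delta> * (\<Sum>j<N. (cmod (c j))\<^sup>2 / (1 - (cmod (l j))\<^sup>2))" (is "?V \<le> ?C * ?D")
    and "(\<Sum>j<N. (cmod (c j))\<^sup>2 / (1 - (cmod (l j))\<^sup>2))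
           \<le> riesz_const \<delta> * (\<Sum>n. (cmod (\<Sum>j<N. c j * l j ^ n))\<^sup>2)"
proof -
  have "?V \<le> ?C * ?D \<and> ?D \<le> ?C * ?V"
  proof (cases "N = 0")
    case True
    then show ?thesis by simp
  next
    case False
    define \<zeta> where "\<zeta> = cis (2 * pi / real N)"
    define V where "V k = (\<Sum>n. (cmod (\<Sum>j<N. \<zeta> ^ (j * k) * c j * l j ^ n))\<^sup>2)" for k
    have norm_\<zeta>: "cmod (\<zeta> ^ i) = 1" for i by (simp add: \<zeta>_def norm_power)
    have summ: "summable (\<lambda>n. (cmod (\<Sum>j<N. d j * l j ^ n))\<^sup>2)" for d
      using disc by (intro summable_norm_sq_geometric_sum) auto
    have geo: "(\<lambda>n. (cmod (c j * l j ^ n))\<^sup>2) sums ((cmod (c j))\<^sup>2 / (1 - (cmod (l j))\<^sup>2))" for j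
      using sums_mult[OF geometric_sums[of "(cmod (l j))\<^sup>2"], of "(cmod (c j))\<^sup>2"] cmod_sq_less_1[OF disc[of j]]
      by (simp add: norm_mult norm_power power_mult_distrib power_mult[symmetric] mult.commute)
    have "(\<Sum>k<N. V k) = (\<Sum>n. \<Sum>k<N. (cmod (\<Sum>j<N. \<zeta> ^ (j * k) * c j * l j ^ n))\<^sup>2)"
      unfolding V_def by (rule suminf_sum[symmetric]) (rule summ)
    also have "\<dots> = (\<Sum>n. real N * (\<Sum>j<N. (cmod (c j * l j ^ n))\<^sup>2))"
    proof (rule arg_cong[of _ _ suminf], rule ext)
      fix n
      show "(\<Sum>k<N. (cmod (\<Sum>j<N. \<zeta> ^ (j * k) * c j * l j ^ n))\<^sup>2) = real N * (\<Sum>j<N. (cmod (c j * l j ^ n))\<^sup>2)"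
        using roots_of_unity_parseval[of N "\<lambda>j. c j * l j ^ n"] False by (simp add: \<zeta>_def mult_ac)
    qed
    also have "\<dots> = real N * ?D"
      by (intro sums_unique[symmetric] sums_mult sums_sum geo)
    finally have avg: "(\<Sum>k<N. V k) = real N * ?D" .
    have "V k \<le> ?C * ?V" for k
      unfolding V_def using disc sep \<delta> norm_\<zeta> by (intro multiplier_le[folded riesz_const_def]) auto
    then have "(\<Sum>k<N. V k) \<le> (\<Sum>k<N. ?C * ?V)" by (intro sum_mono)
    then have le1: "?D \<le> ?C * ?V" using False avg by simp
    have "?V \<le> ?C * V k" for k
    proof -
      have "(\<Sum>n. (cmod (\<Sum>j<N. cnj (\<zeta> ^ (j * k)) * (\<zeta> ^ (j * k) * c j) * l j ^ n))\<^sup>2) \<le> ?C * V k"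
        unfolding V_def using disc sep \<delta> norm_\<zeta> by (intro multiplier_le[folded riesz_const_def]) (auto simp: norm_power)
      moreover have "cnj (\<zeta> ^ (j * k)) * (\<zeta> ^ (j * k) * c j) = c j" for j
        by (simp add: \<zeta>_def Complex.DeMoivre cis_cnj mult.assoc[symmetric] cis_mult del: complex_cnj_power)
      ultimately show ?thesis by (simp only:)
    qed
    then have "(\<Sum>k<N. ?V) \<le> (\<Sum>k<N. ?C * V k)" by (intro sum_mono)
    then have "real N * ?V \<le> real N * (?C * ?D)" using avg by (simp add: sum_distrib_left[symmetric] mult.left_commute)
    then have "?V \<le> ?C * ?D" using False by simp
    with le1 show ?thesis by simp
  qed
  then show "?V \<le> ?C * ?D" "?D \<le> ?C * ?V" by auto
qed

context
  fixes l :: "nat \<Rightarrow> complex" and \<delta> :: real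
  assumes disc: "\<And>j. cmod (l j) < 1"
    and sep: "\<And>N j. j < N \<Longrightarrow> \<delta> \<le> (\<Prod>k\<in>{..<N} - {j}. pseudo_dist (l j) (l k))"
    and \<delta>: "0 < \<delta>"
begin

lemma weight_pos: "1 - (cmod (l j))\<^sup>2 > 0"
  using cmod_sq_less_1[OF disc] by simp

lemma riesz_upper_infinite:
  fixes d :: "nat \<Rightarrow> complex"
  assumes d: "summable (\<lambda>j. cmod (d j))"
    and D: "summable (\<lambda>j. (cmod (d j))\<^sup>2 / (1 - (cmod (l j))\<^sup>2))"
  shows "summable (\<lambda>n. (cmod (\<Sum>j. d j * l j ^ n))\<^sup>2)"
    and "(\<Sum>n. (cmod (\<Sum>j. d j * l j ^ n))\<^sup>2)
      \<le> riesz_const \<delta> * (\<Sum>j. (cmod (d j))\<^sup>2 / (1 - (cmod (l j))\<^sup>2))"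
proof -
  let ?B = "riesz_const \<delta> * (\<Sum>j. (cmod (d j))\<^sup>2 / (1 - (cmod (l j))\<^sup>2))"
  have summ: "summable (\<lambda>j. d j * l j ^ n)" for n
  proof (rule summable_norm_cancel, rule summable_comparison_test'[OF d])
    show "norm (norm (d j * l j ^ n)) \<le> cmod (d j)" for j
      using disc[of j] by (simp add: norm_mult norm_power mult_left_le power_le_one)
  qed
  have fin: "(\<Sum>n<K. (cmod (\<Sum>j. d j * l j ^ n))\<^sup>2) \<le> ?B" for K
  proof (rule LIMSEQ_le_const2)
    show "(\<lambda>N. \<Sum>n<K. (cmod (\<Sum>j<N. d j * l j ^ n))\<^sup>2) \<longlonglongrightarrow> (\<Sum>n<K. (cmod (\<Sum>j. d j * l j ^ n))\<^sup>2)"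
      by (intro tendsto_intros summable_LIMSEQ summ)
    have "(\<Sum>n<K. (cmod (\<Sum>j<N. d j * l j ^ n))\<^sup>2) \<le> ?B" for N
    proof -
      have "(\<Sum>n<K. (cmod (\<Sum>j<N. d j * l j ^ n))\<^sup>2) \<le> (\<Sum>n. (cmod (\<Sum>j<N. d j * l j ^ n))\<^sup>2)"
        using disc by (intro sum_le_suminf summable_norm_sq_geometric_sum) auto
      also have "\<dots> \<le> riesz_const \<delta> * (\<Sum>j<N. (cmod (d j))\<^sup>2 / (1 - (cmod (l j))\<^sup>2))"
        using disc sep \<delta> by (intro riesz_finite(1)) auto
      also have "\<dots> \<le> ?B"
        using weight_pos by (intro mult_left_mono sum_le_suminf D) (auto simp: less_imp_le riesz_const_def)
      finally show ?thesis .
    qed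
    then show "\<exists>N0. \<forall>N\<ge>N0. (\<Sum>n<K. (cmod (\<Sum>j<N. d j * l j ^ n))\<^sup>2) \<le> ?B" by blast
  qed
  show "summable (\<lambda>n. (cmod (\<Sum>j. d j * l j ^ n))\<^sup>2)"
    by (rule summableI_nonneg_bounded[OF _ fin]) simp
  then show "(\<Sum>n. (cmod (\<Sum>j. d j * l j ^ n))\<^sup>2) \<le> ?B"
    using fin by (intro suminf_le_const)
qed

text \<open>The lower bound for the first \<open>N\<close> nodes passes to the limit because the remaining nodes contribute
  little, by the upper bound applied to the tail.  The factor \<open>2\<close> comes from
  \<open>\<bar>x\<bar>\<^sup>2 \<le> 2 \<bar>y\<bar>\<^sup>2 + 2 \<bar>x - y\<bar>\<^sup>2\<close>.\<close>

lemma riesz_lower_infinite: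
  fixes d :: "nat \<Rightarrow> complex"
  assumes d: "summable (\<lambda>j. cmod (d j))"
    and D: "summable (\<lambda>j. (cmod (d j))\<^sup>2 / (1 - (cmod (l j))\<^sup>2))"
  shows "(\<Sum>j. (cmod (d j))\<^sup>2 / (1 - (cmod (l j))\<^sup>2))
      \<le> 2 * riesz_const \<delta> * (\<Sum>n. (cmod (\<Sum>j. d j * l j ^ n))\<^sup>2)"
proof -
  let ?C = "riesz_const \<delta>"
  let ?f = "\<lambda>j. (cmod (d j))\<^sup>2 / (1 - (cmod (l j))\<^sup>2)"
  let ?V = "\<lambda>n. \<Sum>j. d j * l j ^ n"
  have V: "summable (\<lambda>n. (cmod (?V n))\<^sup>2)" by (rule riesz_upper_infinite(1)[OF d D])
  have le: "(\<Sum>j<N. ?f j) \<le> 2 * ?C * (\<Sum>n. (cmod (?V n))\<^sup>2) + 2 * ?C\<^sup>2 * (suminf ?f - (\<Sum>j<N. ?f j))" for N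
  proof -
    define t where "t j = (if j < N then 0 else d j)" for j
    have t: "summable (\<lambda>j. cmod (t j))"
      by (rule summable_comparison_test'[OF d]) (simp add: t_def)
    have T: "(\<lambda>j. (cmod (t j))\<^sup>2 / (1 - (cmod (l j))\<^sup>2)) sums (suminf ?f - (\<Sum>j<N. ?f j))"
    proof -
      have "(\<lambda>j. ?f j - (if j \<in> {..<N} then ?f j else 0)) sums (suminf ?f - (\<Sum>j<N. ?f j))"
        by (intro sums_diff summable_sums D sums_If_finite_set) auto
      then show ?thesis by (rule sums_cong[THEN iffD1, rotated]) (auto simp: t_def)
    qed
    have summ: "summable (\<lambda>j. t j * l j ^ n)" for n
    proof (rule summable_norm_cancel, rule summable_comparison_test'[OF t])
      show "norm (norm (t j * l j ^ n)) \<le> cmod (t j)" for j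
        using disc[of j] by (simp add: norm_mult norm_power mult_left_le power_le_one)
    qed
    have split: "?V n = (\<Sum>j<N. d j * l j ^ n) + (\<Sum>j. t j * l j ^ n)" for n
    proof -
      have "(\<lambda>j. (if j \<in> {..<N} then d j * l j ^ n else 0) + t j * l j ^ n)
          sums ((\<Sum>j<N. d j * l j ^ n) + (\<Sum>j. t j * l j ^ n))"
        by (intro sums_add summable_sums summ sums_If_finite_set) auto
      then have "(\<lambda>j. d j * l j ^ n) sums ((\<Sum>j<N. d j * l j ^ n) + (\<Sum>j. t j * l j ^ n))"
        by (rule sums_cong[THEN iffD1, rotated]) (auto simp: t_def)
      then show ?thesis by (simp add: sums_iff)
    qed
    note bt = riesz_upper_infinite[OF t sums_summable[OF T]]
    have pt: "(cmod (\<Sum>j<N. d j * l j ^ n))\<^sup>2 \<le> 2 * (cmod (?V n))\<^sup>2 + 2 * (cmod (\<Sum>j. t j * l j ^ n))\<^sup>2" for n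
    proof -
      have "cmod (\<Sum>j<N. d j * l j ^ n) = cmod (?V n - (\<Sum>j. t j * l j ^ n))" by (simp add: split)
      also have "\<dots> \<le> cmod (?V n) + cmod (\<Sum>j. t j * l j ^ n)" by (rule norm_triangle_ineq4)
      finally have "(cmod (\<Sum>j<N. d j * l j ^ n))\<^sup>2 \<le> (cmod (?V n) + cmod (\<Sum>j. t j * l j ^ n))\<^sup>2"
        by (intro power_mono) auto
      then show ?thesis using sum_squares_bound[of "cmod (?V n)" "cmod (\<Sum>j. t j * l j ^ n)"]
        by (simp add: power2_sum)
    qed
    have low: "(\<Sum>j<N. ?f j) \<le> ?C * (\<Sum>n. (cmod (\<Sum>j<N. d j * l j ^ n))\<^sup>2)"
      using disc sep \<delta> by (intro riesz_finite(2)) auto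
    have "(\<Sum>n. (cmod (\<Sum>j<N. d j * l j ^ n))\<^sup>2)
        \<le> (\<Sum>n. 2 * (cmod (?V n))\<^sup>2 + 2 * (cmod (\<Sum>j. t j * l j ^ n))\<^sup>2)"
      using disc V bt(1) by (intro suminf_le pt summable_norm_sq_geometric_sum summable_add summable_mult) auto
    also have "\<dots> = 2 * (\<Sum>n. (cmod (?V n))\<^sup>2) + 2 * (\<Sum>n. (cmod (\<Sum>j. t j * l j ^ n))\<^sup>2)"
      using V bt(1) by (simp add: suminf_add[symmetric] suminf_mult summable_mult)
    also have "\<dots> \<le> 2 * (\<Sum>n. (cmod (?V n))\<^sup>2) + 2 * (?C * (suminf ?f - (\<Sum>j<N. ?f j)))"
      using bt(2) T by (simp add: sums_iff)
    finally have "?C * (\<Sum>n. (cmod (\<Sum>j<N. d j * l j ^ n))\<^sup>2)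
        \<le> ?C * (2 * (\<Sum>n. (cmod (?V n))\<^sup>2) + 2 * (?C * (suminf ?f - (\<Sum>j<N. ?f j))))"
      by (rule mult_left_mono) (rule riesz_const_nonneg)
    with low have "(\<Sum>j<N. ?f j) \<le> ?C * (2 * (\<Sum>n. (cmod (?V n))\<^sup>2) + 2 * (?C * (suminf ?f - (\<Sum>j<N. ?f j))))"
      by linarith
    then show ?thesis by (simp add: power2_eq_square distrib_left mult_ac)
  qed
  have lim: "(\<lambda>N. \<Sum>j<N. ?f j) \<longlonglongrightarrow> suminf ?f" by (rule summable_LIMSEQ[OF D])
  have "(\<lambda>N. 2 * ?C * (\<Sum>n. (cmod (?V n))\<^sup>2) + 2 * ?C\<^sup>2 * (suminf ?f - (\<Sum>j<N. ?f j)))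
      \<longlonglongrightarrow> 2 * ?C * (\<Sum>n. (cmod (?V n))\<^sup>2) + 2 * ?C\<^sup>2 * (suminf ?f - suminf ?f)"
    by (intro tendsto_intros lim)
  from LIMSEQ_le[OF lim this] le
  have "suminf ?f \<le> 2 * ?C * (\<Sum>n. (cmod (?V n))\<^sup>2) + 2 * ?C\<^sup>2 * (suminf ?f - suminf ?f)" by blast
  then show ?thesis by simp
qed

end

section \<open>Square-integrable functions on the torus\<close>

lemma torus_sets [simp, measurable]: "torus \<in> sets lebesgue"
  by (simp add: torus_def)

lemma finite_measure_torus: "finite_measure torus_measure"
proof (rule finite_measure_lebesgue_on, rule bounded_set_imp_lmeasurable)
  show "bounded torus"
    by (rule bounded_subset[OF bounded_closed_interval[of "-1/2" "1/2"]]) (auto simp: torus_def)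
qed simp

lemma L2_torusD:
  assumes "f \<in> L2_torus"
  shows "f \<in> borel_measurable torus_measure" "integrable torus_measure (\<lambda>\<xi>. (cmod (f \<xi>))\<^sup>2)"
  using assms by (auto simp: L2_torus_def)

lemma L2_onD:
  assumes "f \<in> L2_on \<Omega>"
  shows "f \<in> L2_torus" "AE \<xi> in torus_measure. \<xi> \<notin> \<Omega> \<longrightarrow> f \<xi> = 0"
  using assms by (auto simp: L2_on_def)

lemma L2_torus_scale: "f \<in> L2_torus \<Longrightarrow> (\<lambda>\<xi>. c * f \<xi>) \<in> L2_torus"
  by (auto simp: L2_torus_def norm_mult power_mult_distrib)

lemma norm_add_sq_le: "(cmod (x + y))\<^sup>2 \<le> 2 * (cmod x)\<^sup>2 + 2 * (cmod y)\<^sup>2"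
proof -
  have "(cmod (x + y))\<^sup>2 \<le> (cmod x + cmod y)\<^sup>2" by (intro power_mono norm_triangle_ineq) simp
  then show ?thesis using sum_squares_bound[of "cmod x" "cmod y"] by (simp add: power2_sum)
qed

lemma L2_torus_add:
  assumes "f \<in> L2_torus" "g \<in> L2_torus"
  shows "(\<lambda>\<xi>. f \<xi> + g \<xi>) \<in> L2_torus"
proof -
  note [measurable] = L2_torusD(1)[OF assms(1)] L2_torusD(1)[OF assms(2)]
  have "integrable torus_measure (\<lambda>\<xi>. (cmod (f \<xi> + g \<xi>))\<^sup>2)"
  proof (rule Bochner_Integration.integrable_bound)
    show "integrable torus_measure (\<lambda>\<xi>. 2 * (cmod (f \<xi>))\<^sup>2 + 2 * (cmod (g \<xi>))\<^sup>2)"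
      using L2_torusD(2)[OF assms(1)] L2_torusD(2)[OF assms(2)] by simp
  qed (use norm_add_sq_le in auto)
  then show ?thesis by (simp add: L2_torus_def)
qed

lemma L2_torus_diff:
  assumes "f \<in> L2_torus" "g \<in> L2_torus"
  shows "(\<lambda>\<xi>. f \<xi> - g \<xi>) \<in> L2_torus"
  using L2_torus_add[OF assms(1) L2_torus_scale[OF assms(2), of "-1"]] by simp

lemma L2_torus_zero: "(\<lambda>\<xi>. 0) \<in> L2_torus"
  by (simp add: L2_torus_def)

lemma L2_torus_sum:
  assumes "\<And>j. j \<in> A \<Longrightarrow> f j \<in> L2_torus"
  shows "(\<lambda>\<xi>. \<Sum>j\<in>A. f j \<xi>) \<in> L2_torus"
  using assms
  by (induction A rule: infinite_finite_induct) (auto intro: L2_torus_add L2_torus_zero)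

lemma L2_torus_bounded:
  assumes "f \<in> borel_measurable torus_measure" "AE \<xi> in torus_measure. cmod (f \<xi>) \<le> K"
  shows "f \<in> L2_torus"
proof -
  note [measurable] = assms(1)
  interpret finite_measure torus_measure by (rule finite_measure_torus)
  have "integrable torus_measure (\<lambda>\<xi>. (cmod (f \<xi>))\<^sup>2)"
  proof (rule integrable_const_bound[of _ "K\<^sup>2"])
    show "AE \<xi> in torus_measure. norm ((cmod (f \<xi>))\<^sup>2) \<le> K\<^sup>2"
      using assms(2) by eventually_elim (auto intro: power_mono)
  qed simp
  then show ?thesis using assms(1) by (simp add: L2_torus_def)
qed

lemma L2_inner_integrable:
  assumes "f \<in> L2_torus" "g \<in> L2_torus"
  shows "integrable torus_measure (\<lambda>\<xi>. f \<xi> * cnj (g \<xi>))"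
proof (rule Bochner_Integration.integrable_bound)
  note [measurable] = L2_torusD(1)[OF assms(1)] L2_torusD(1)[OF assms(2)]
  show "integrable torus_measure (\<lambda>\<xi>. (cmod (f \<xi>))\<^sup>2 + (cmod (g \<xi>))\<^sup>2)"
    using L2_torusD(2)[OF assms(1)] L2_torusD(2)[OF assms(2)] by simp
  show "(\<lambda>\<xi>. f \<xi> * cnj (g \<xi>)) \<in> borel_measurable torus_measure"
    by (intro borel_measurable_times L2_torusD(1)[OF assms(1)]
        measurable_compose[OF L2_torusD(1)[OF assms(2)] borel_measurable_continuous_onI]
        continuous_intros)
  have "cmod x * cmod y \<le> (cmod x)\<^sup>2 + (cmod y)\<^sup>2" for x y
  proof -
    have "0 \<le> cmod x * cmod y" by simp
    with sum_squares_bound[of "cmod x" "cmod y"] show ?thesis by linarith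
  qed
  then show "AE \<xi> in torus_measure. norm (f \<xi> * cnj (g \<xi>)) \<le> norm ((cmod (f \<xi>))\<^sup>2 + (cmod (g \<xi>))\<^sup>2)"
    by (simp add: norm_mult)
qed

lemma L2_inner_scale_left: "L2_inner (\<lambda>\<xi>. c * f \<xi>) g = c * L2_inner f g"
  by (simp add: L2_inner_def mult.assoc)

lemma L2_inner_diff_left:
  assumes "f \<in> L2_torus" "g \<in> L2_torus" "h \<in> L2_torus"
  shows "L2_inner (\<lambda>\<xi>. f \<xi> - g \<xi>) h = L2_inner f h - L2_inner g h"
  using L2_inner_integrable[OF assms(1,3)] L2_inner_integrable[OF assms(2,3)]
  by (simp add: L2_inner_def left_diff_distrib)

lemma L2_inner_sum_left:
  assumes "\<And>j. j \<in> A \<Longrightarrow> f j \<in> L2_torus" "g \<in> L2_torus"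
  shows "L2_inner (\<lambda>\<xi>. \<Sum>j\<in>A. f j \<xi>) g = (\<Sum>j\<in>A. L2_inner (f j) g)"
  using L2_inner_integrable[OF assms(1) assms(2)]
  by (simp add: L2_inner_def sum_distrib_right)

lemma L2_inner_commute: "L2_inner g f = cnj (L2_inner f g)"
  unfolding L2_inner_def Bochner_Integration.integral_cnj[symmetric] by (simp add: mult.commute)

lemma L2_norm_nonneg: "L2_norm f \<ge> 0"
  by (simp add: L2_norm_def)

lemma L2_norm_sq: "(L2_norm f)\<^sup>2 = (LINT \<xi>|torus_measure. (cmod (f \<xi>))\<^sup>2)"
  by (simp add: L2_norm_def)

lemma L2_norm_sq_eq_inner: "complex_of_real ((L2_norm f)\<^sup>2) = L2_inner f f"
  unfolding L2_norm_sq L2_inner_def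
  by (simp add: complex_norm_square del: of_real_power flip: integral_complex_of_real)

lemma L2_norm_diff_sq:
  assumes f: "f \<in> L2_torus" and g: "g \<in> L2_torus"
  shows "(L2_norm (\<lambda>\<xi>. f \<xi> - g \<xi>))\<^sup>2 = (L2_norm f)\<^sup>2 - 2 * Re (L2_inner f g) + (L2_norm g)\<^sup>2"
proof -
  note d = L2_torus_diff[OF f g]
  have "complex_of_real ((L2_norm (\<lambda>\<xi>. f \<xi> - g \<xi>))\<^sup>2)
      = cnj (L2_inner f f - L2_inner g f) - cnj (L2_inner f g - L2_inner g g)"
    unfolding L2_norm_sq_eq_inner L2_inner_diff_left[OF f g d]
    by (subst (1 2) L2_inner_commute) (simp only: L2_inner_diff_left f g)
  also have "\<dots> = L2_inner f f - (L2_inner f g + cnj (L2_inner f g)) + L2_inner g g"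
    using L2_inner_commute[of f f] L2_inner_commute[of g g] L2_inner_commute[of f g] L2_inner_commute[of g f]
    by simp
  also have "\<dots> = complex_of_real ((L2_norm f)\<^sup>2 - 2 * Re (L2_inner f g) + (L2_norm g)\<^sup>2)"
    by (simp add: complex_add_cnj L2_norm_sq_eq_inner[symmetric])
  finally show ?thesis by (simp only: of_real_eq_iff)
qed

lemma L2_norm_scale: "L2_norm (\<lambda>\<xi>. c * f \<xi>) = cmod c * L2_norm f"
  by (simp add: L2_norm_def norm_mult power_mult_distrib real_sqrt_mult)

text \<open>Expanding \<open>\<parallel>f - r \<langle>f, g\<rangle> g\<parallel>\<^sup>2 \<ge> 0\<close> with real \<open>r\<close> covers null functions \<open>g\<close> as well, by letting \<open>r\<close> grow.\<close>

lemma L2_Cauchy_Schwarz: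
  assumes f: "f \<in> L2_torus" and g: "g \<in> L2_torus"
  shows "cmod (L2_inner f g) \<le> L2_norm f * L2_norm g"
proof -
  let ?p = "L2_inner f g"
  have *: "0 \<le> (L2_norm f)\<^sup>2 - 2 * r * (cmod ?p)\<^sup>2 + r\<^sup>2 * (cmod ?p)\<^sup>2 * (L2_norm g)\<^sup>2" for r :: real
  proof -
    have cnj_p: "cnj (of_real r * ?p) * ?p = of_real (r * (cmod ?p)\<^sup>2)"
      by (simp add: complex_norm_square mult_ac del: of_real_power)
    have "L2_inner f (\<lambda>\<xi>. (of_real r * ?p) * g \<xi>) = cnj (of_real r * ?p) * ?p"
      by (subst L2_inner_commute) (simp add: L2_inner_scale_left L2_inner_commute[of g f])
    then have "L2_inner f (\<lambda>\<xi>. (of_real r * ?p) * g \<xi>) = of_real (r * (cmod ?p)\<^sup>2)"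
      by (rule trans) (rule cnj_p)
    then have "Re (L2_inner f (\<lambda>\<xi>. (of_real r * ?p) * g \<xi>)) = r * (cmod ?p)\<^sup>2"
      by (simp only: Re_complex_of_real)
    moreover have "0 \<le> (L2_norm (\<lambda>\<xi>. f \<xi> - (of_real r * ?p) * g \<xi>))\<^sup>2" by simp
    ultimately show ?thesis
      unfolding L2_norm_diff_sq[OF f L2_torus_scale[OF g]] L2_norm_scale
      by (simp add: norm_mult power_mult_distrib)
  qed
  have "(cmod ?p)\<^sup>2 \<le> (L2_norm f)\<^sup>2 * (L2_norm g)\<^sup>2"
  proof (cases "L2_norm g = 0")
    case True
    have "(cmod ?p)\<^sup>2 = 0"
    proof (rule ccontr)
      assume "(cmod ?p)\<^sup>2 \<noteq> 0"
      then show False using *[of "((L2_norm f)\<^sup>2 + 1) / (2 * (cmod ?p)\<^sup>2)"] True by (simp add: field_simps)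
    qed
    then show ?thesis by simp
  next
    case False
    then have "(L2_norm g)\<^sup>2 > 0" by simp
    moreover have "P \<le> F * G" if "0 \<le> F - 2 * (1 / G) * P + (1 / G)\<^sup>2 * P * G" "G > 0" for F G P :: real
      using that by (simp add: field_simps power2_eq_square)
    ultimately show ?thesis using *[of "1 / (L2_norm g)\<^sup>2"] by blast
  qed
  then have "(cmod ?p)\<^sup>2 \<le> (L2_norm f * L2_norm g)\<^sup>2" by (simp add: power_mult_distrib)
  then show ?thesis by (rule power2_le_imp_le) (simp add: L2_norm_nonneg)
qed

lemma L2_inner_tendsto:
  assumes u: "\<And>N. u N \<in> L2_torus" and g: "g \<in> L2_torus" and h: "h \<in> L2_torus"
    and lim: "(\<lambda>N. L2_norm (\<lambda>\<xi>. g \<xi> - u N \<xi>)) \<longlonglongrightarrow> 0"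
  shows "(\<lambda>N. L2_inner (u N) h) \<longlonglongrightarrow> L2_inner g h"
proof -
  have "(\<lambda>N. L2_inner g h - L2_inner (u N) h) \<longlonglongrightarrow> 0"
  proof (rule Lim_null_comparison)
    show "\<forall>\<^sub>F N in sequentially. cmod (L2_inner g h - L2_inner (u N) h)
        \<le> L2_norm (\<lambda>\<xi>. g \<xi> - u N \<xi>) * L2_norm h"
      using L2_Cauchy_Schwarz[OF L2_torus_diff[OF g u] h]
      by (simp add: L2_inner_diff_left[OF g u h])
    show "(\<lambda>N. L2_norm (\<lambda>\<xi>. g \<xi> - u N \<xi>) * L2_norm h) \<longlonglongrightarrow> 0"
      using tendsto_mult_right[OF lim, of "L2_norm h"] by simp
  qed
  from tendsto_diff[OF tendsto_const[of "L2_inner g h"] this] show ?thesis by simp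
qed

section \<open>Expansion in an orthonormal system\<close>

text \<open>Membership in the closed linear span of \<open>e\<close>.\<close>

definition L2_approximable :: "(nat \<Rightarrow> real \<Rightarrow> complex) \<Rightarrow> (real \<Rightarrow> complex) \<Rightarrow> bool" where
  "L2_approximable e f \<longleftrightarrow>
     (\<forall>\<epsilon>>0. \<exists>N c. (L2_norm (\<lambda>\<xi>. f \<xi> - (\<Sum>j<N. c j * e j \<xi>)))\<^sup>2 < \<epsilon>)"

lemma L2_norm_sq_add_le:
  assumes f: "f \<in> L2_torus" and g: "g \<in> L2_torus"
  shows "(L2_norm (\<lambda>\<xi>. f \<xi> + g \<xi>))\<^sup>2 \<le> 2 * (L2_norm f)\<^sup>2 + 2 * (L2_norm g)\<^sup>2"
proof -
  have "(L2_norm (\<lambda>\<xi>. f \<xi> + g \<xi>))\<^sup>2 \<le> (LINT \<xi>|torus_measure. 2 * (cmod (f \<xi>))\<^sup>2 + 2 * (cmod (g \<xi>))\<^sup>2)"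
    unfolding L2_norm_sq using f g L2_torus_add[OF f g]
    by (intro integral_mono norm_add_sq_le) (auto simp: L2_torus_def)
  also have "\<dots> = 2 * (L2_norm f)\<^sup>2 + 2 * (L2_norm g)\<^sup>2"
    unfolding L2_norm_sq using f g by (simp add: L2_torus_def)
  finally show ?thesis .
qed

lemma L2_approximable_limit:
  assumes e: "\<And>j. e j \<in> L2_torus" and f: "f \<in> L2_torus"
    and u: "\<And>n. u n \<in> L2_torus" "\<And>n. L2_approximable e (u n)"
    and lim: "(\<lambda>n. (L2_norm (\<lambda>\<xi>. f \<xi> - u n \<xi>))\<^sup>2) \<longlonglongrightarrow> 0"
  shows "L2_approximable e f"
  unfolding L2_approximable_def
proof (intro allI impI)
  fix \<epsilon> :: real assume "\<epsilon> > 0"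
  then have "\<forall>\<^sub>F n in sequentially. (L2_norm (\<lambda>\<xi>. f \<xi> - u n \<xi>))\<^sup>2 < \<epsilon> / 4"
    using order_tendstoD(2)[OF lim, of "\<epsilon> / 4"] by simp
  then obtain n where n: "(L2_norm (\<lambda>\<xi>. f \<xi> - u n \<xi>))\<^sup>2 < \<epsilon> / 4"
    by (auto simp: eventually_sequentially)
  obtain N c where c: "(L2_norm (\<lambda>\<xi>. u n \<xi> - (\<Sum>j<N. c j * e j \<xi>)))\<^sup>2 < \<epsilon> / 4"
    using u(2)[of n] \<open>\<epsilon> > 0\<close> unfolding L2_approximable_def by (metis divide_pos_pos zero_less_numeral)
  have "(L2_norm (\<lambda>\<xi>. (f \<xi> - u n \<xi>) + (u n \<xi> - (\<Sum>j<N. c j * e j \<xi>))))\<^sup>2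
      \<le> 2 * (L2_norm (\<lambda>\<xi>. f \<xi> - u n \<xi>))\<^sup>2 + 2 * (L2_norm (\<lambda>\<xi>. u n \<xi> - (\<Sum>j<N. c j * e j \<xi>)))\<^sup>2"
    by (intro L2_norm_sq_add_le L2_torus_diff L2_torus_sum L2_torus_scale f u e)
  then have "(L2_norm (\<lambda>\<xi>. f \<xi> - (\<Sum>j<N. c j * e j \<xi>)))\<^sup>2 < \<epsilon>" using n c by simp
  then show "\<exists>N c. (L2_norm (\<lambda>\<xi>. f \<xi> - (\<Sum>j<N. c j * e j \<xi>)))\<^sup>2 < \<epsilon>" by blast
qed

lemma L2_norm_sq_tendsto_dominated:
  assumes f: "f \<in> L2_torus" and u: "\<And>n. u n \<in> L2_torus" and g: "integrable torus_measure g"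
    and ae: "AE \<xi> in torus_measure. (\<lambda>n. u n \<xi>) \<longlonglongrightarrow> f \<xi>"
    and bound: "\<And>n. AE \<xi> in torus_measure. (cmod (f \<xi> - u n \<xi>))\<^sup>2 \<le> g \<xi>"
  shows "(\<lambda>n. (L2_norm (\<lambda>\<xi>. f \<xi> - u n \<xi>))\<^sup>2) \<longlonglongrightarrow> 0"
proof -
  note [measurable] = L2_torusD(1)[OF f] L2_torusD(1)[OF u] borel_measurable_integrable[OF g]
  have "(\<lambda>n. LINT \<xi>|torus_measure. (cmod (f \<xi> - u n \<xi>))\<^sup>2) \<longlonglongrightarrow> (LINT \<xi>|torus_measure. 0)"
  proof (rule integral_dominated_convergence[OF _ _ g])
    show "AE \<xi> in torus_measure. (\<lambda>n. (cmod (f \<xi> - u n \<xi>))\<^sup>2) \<longlonglongrightarrow> 0"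
      using ae
    proof eventually_elim
      case (elim \<xi>)
      have "(\<lambda>n. (cmod (f \<xi> - u n \<xi>))\<^sup>2) \<longlonglongrightarrow> (cmod (f \<xi> - f \<xi>))\<^sup>2"
        by (intro tendsto_intros elim)
      then show ?case by simp
    qed
  qed (use bound in auto)
  then show ?thesis by (simp add: L2_norm_sq)
qed

text \<open>Among all combinations of the first \<open>N\<close> basis vectors the orthogonal projection is closest to
  \<open>f\<close>, and the excess of any other combination is explicit.\<close>

lemma L2_projection_distance:
  fixes e :: "nat \<Rightarrow> real \<Rightarrow> complex"
  assumes e: "\<And>j. e j \<in> L2_torus" and f: "f \<in> L2_torus"
    and on: "\<And>i j. L2_inner (e i) (e j) = (if i = j then 1 else 0)"
  shows "(L2_norm (\<lambda>\<xi>. f \<xi> - (\<Sum>j<N. c j * e j \<xi>)))\<^sup>2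
    = (L2_norm f)\<^sup>2 - (\<Sum>j<N. (cmod (L2_inner f (e j)))\<^sup>2) + (\<Sum>j<N. (cmod (L2_inner f (e j) - c j))\<^sup>2)"
proof -
  let ?g = "\<lambda>\<xi>. \<Sum>j<N. c j * e j \<xi>"
  have g: "?g \<in> L2_torus" by (intro L2_torus_sum L2_torus_scale e)
  have left: "L2_inner ?g h = (\<Sum>j<N. c j * L2_inner (e j) h)" if "h \<in> L2_torus" for h
    by (simp add: L2_inner_sum_left L2_torus_scale e that L2_inner_scale_left)
  have right: "L2_inner h ?g = (\<Sum>j<N. cnj (c j) * L2_inner h (e j))" if "h \<in> L2_torus" for h
    by (subst L2_inner_commute) (simp add: left[OF that] L2_inner_commute[of h])
  have "(\<Sum>j<N. cnj (c j) * L2_inner (e i) (e j)) = cnj (c i)" if "i < N" for i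
  proof -
    have "(\<Sum>j<N. cnj (c j) * L2_inner (e i) (e j)) = (\<Sum>j\<in>{i}. cnj (c j) * L2_inner (e i) (e j))"
      by (rule sum.mono_neutral_right) (use that in \<open>auto simp: on\<close>)
    then show ?thesis by (simp add: on)
  qed
  then have "L2_inner ?g ?g = (\<Sum>j<N. c j * cnj (c j))"
    by (simp add: left[OF g] right[OF e])
  then have "complex_of_real ((L2_norm ?g)\<^sup>2) = complex_of_real (\<Sum>j<N. (cmod (c j))\<^sup>2)"
    by (simp add: L2_norm_sq_eq_inner complex_norm_square del: of_real_power)
  then have gg: "(L2_norm ?g)\<^sup>2 = (\<Sum>j<N. (cmod (c j))\<^sup>2)" by (simp only: of_real_eq_iff)
  have "- (\<Sum>j<N. (cmod (L2_inner f (e j)))\<^sup>2) + (\<Sum>j<N. (cmod (L2_inner f (e j) - c j))\<^sup>2)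
     = - 2 * Re (\<Sum>j<N. cnj (c j) * L2_inner f (e j)) + (\<Sum>j<N. (cmod (c j))\<^sup>2)"
    unfolding Re_sum sum_negf[symmetric] sum_distrib_left sum.distrib[symmetric] cmod_power2
    by (intro sum.cong refl) (simp add: power2_eq_square algebra_simps)
  then show ?thesis
    unfolding L2_norm_diff_sq[OF f g] gg right[OF f] by simp
qed

context
  fixes e :: "nat \<Rightarrow> real \<Rightarrow> complex"
  assumes e: "\<And>j. e j \<in> L2_torus"
    and on: "\<And>i j. L2_inner (e i) (e j) = (if i = j then 1 else 0)"
begin

lemma L2_parseval:
  assumes f: "f \<in> L2_torus" and approx: "L2_approximable e f"
  shows "(\<lambda>j. (cmod (L2_inner f (e j)))\<^sup>2) sums (L2_norm f)\<^sup>2"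
proof -
  let ?s = "\<lambda>N. \<Sum>j<N. (cmod (L2_inner f (e j)))\<^sup>2"
  have le: "?s N \<le> (L2_norm f)\<^sup>2" for N
    using L2_projection_distance[OF e f on, where c = "\<lambda>j. L2_inner f (e j)" and N = N]
      zero_le_power2[of "L2_norm (\<lambda>\<xi>. f \<xi> - (\<Sum>j<N. L2_inner f (e j) * e j \<xi>))"] by simp
  have mono: "?s N \<le> ?s K" if "N \<le> K" for N K using that by (intro sum_mono2) auto
  have "?s \<longlonglongrightarrow> (L2_norm f)\<^sup>2"
  proof (rule LIMSEQ_I)
    fix r :: real assume "r > 0"
    then obtain N c where "(L2_norm (\<lambda>\<xi>. f \<xi> - (\<Sum>j<N. c j * e j \<xi>)))\<^sup>2 < r"
      using approx unfolding L2_approximable_def by blast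
    then have "(L2_norm f)\<^sup>2 - ?s N + (\<Sum>j<N. (cmod (L2_inner f (e j) - c j))\<^sup>2) < r"
      unfolding L2_projection_distance[OF e f on] .
    moreover have "(\<Sum>j<N. (cmod (L2_inner f (e j) - c j))\<^sup>2) \<ge> 0" by (intro sum_nonneg) auto
    ultimately have "(L2_norm f)\<^sup>2 - ?s N < r" by simp
    then have "norm (?s K - (L2_norm f)\<^sup>2) < r" if "K \<ge> N" for K
      using le[of K] mono[OF that] by simp
    then show "\<exists>N. \<forall>K\<ge>N. norm (?s K - (L2_norm f)\<^sup>2) < r" by blast
  qed
  then show ?thesis by (simp add: sums_def)
qed

lemma L2_inner_expansion:
  assumes f: "f \<in> L2_torus" and approx: "L2_approximable e f" and g: "g \<in> L2_torus"
  shows "(\<lambda>j. L2_inner f (e j) * cnj (L2_inner g (e j))) sums L2_inner f g"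
proof -
  let ?u = "\<lambda>N \<xi>. \<Sum>j<N. L2_inner f (e j) * e j \<xi>"
  have u: "?u N \<in> L2_torus" for N by (intro L2_torus_sum L2_torus_scale e)
  have "(\<lambda>N. (L2_norm f)\<^sup>2 - (\<Sum>j<N. (cmod (L2_inner f (e j)))\<^sup>2)) \<longlonglongrightarrow> (L2_norm f)\<^sup>2 - (L2_norm f)\<^sup>2"
    using L2_parseval[OF f approx] by (intro tendsto_intros) (simp add: sums_def)
  then have "(\<lambda>N. (L2_norm (\<lambda>\<xi>. f \<xi> - ?u N \<xi>))\<^sup>2) \<longlonglongrightarrow> 0"
    using L2_projection_distance[OF e f on, where c = "\<lambda>j. L2_inner f (e j)"] by simp
  then have "(\<lambda>N. sqrt ((L2_norm (\<lambda>\<xi>. f \<xi> - ?u N \<xi>))\<^sup>2)) \<longlonglongrightarrow> sqrt 0"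
    by (rule tendsto_real_sqrt)
  then have "(\<lambda>N. L2_norm (\<lambda>\<xi>. f \<xi> - ?u N \<xi>)) \<longlonglongrightarrow> 0" by (simp add: L2_norm_nonneg)
  from L2_inner_tendsto[OF u f g this]
  show ?thesis
    by (simp add: sums_def L2_inner_sum_left L2_torus_scale e g L2_inner_scale_left L2_inner_commute[of _ g, symmetric])
qed

end

section \<open>Trigonometric polynomials on the circle\<close>

text \<open>Trigonometric polynomials are described by closure rules, so that both the passage from real
  polynomials and the passage to finite combinations of exponentials are plain inductions.\<close>

inductive trig_poly :: "(real \<Rightarrow> complex) \<Rightarrow> bool" where
  monom: "trig_poly (\<lambda>\<theta>. c * cis (of_int k * \<theta>))"
| add: "trig_poly f \<Longrightarrow> trig_poly g \<Longrightarrow> trig_poly (\<lambda>\<theta>. f \<theta> + g \<theta>)"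

lemma trig_poly_const: "trig_poly (\<lambda>\<theta>. c)"
  using trig_poly.monom[of c 0] by simp

lemma trig_poly_mult:
  assumes "trig_poly f" "trig_poly g"
  shows "trig_poly (\<lambda>\<theta>. f \<theta> * g \<theta>)"
  using assms
proof (induction arbitrary: g)
  case (monom c k)
  from monom show ?case
  proof induction
    case (monom d m)
    have "(\<lambda>\<theta>. c * cis (of_int k * \<theta>) * (d * cis (of_int m * \<theta>)))
        = (\<lambda>\<theta>. (c * d) * cis (of_int (k + m) * \<theta>))"
    proof
      fix \<theta>
      have "cis (of_int (k + m) * \<theta>) = cis (of_int k * \<theta>) * cis (of_int m * \<theta>)"
        by (simp add: cis_mult distrib_right)
      then show "c * cis (of_int k * \<theta>) * (d * cis (of_int m * \<theta>)) = (c * d) * cis (of_int (k + m) * \<theta>)"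
        by (simp only: mult_ac)
    qed
    then show ?case using trig_poly.monom[of "c * d" "k + m"] by (simp only:)
  next
    case (add g h)
    then show ?case using trig_poly.add by (simp add: distrib_left)
  qed
next
  case (add f h)
  then show ?case using trig_poly.add by (simp add: distrib_right)
qed

text \<open>A real polynomial in the two coordinates of \<open>cis \<theta>\<close> is a polynomial in \<open>cos \<theta>\<close> and \<open>sin \<theta>\<close>.\<close>

lemma trig_poly_real_polynomial_function:
  assumes "real_polynomial_function P"
  shows "trig_poly (\<lambda>\<theta>. complex_of_real (P (cis \<theta>)))"
  using assms
proof induction
  case (linear f)
  interpret bounded_linear f by fact
  have "complex_of_real (f (cis \<theta>))
      = of_real (f 1 / 2) * (cis (of_int 1 * \<theta>) + cis (of_int (-1) * \<theta>))
      + (of_real (f \<i>) / (2 * \<i>)) * (cis (of_int 1 * \<theta>) + (-1) * cis (of_int (-1) * \<theta>))" for \<theta>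
  proof -
    have "cis \<theta> = cos \<theta> *\<^sub>R 1 + sin \<theta> *\<^sub>R \<i>" by (simp add: complex_eq_iff)
    then have "f (cis \<theta>) = cos \<theta> * f 1 + sin \<theta> * f \<i>" by (simp only: add scaleR) simp
    moreover have "cis (of_int 1 * \<theta>) + cis (of_int (-1) * \<theta>) = of_real (2 * cos \<theta>)"
      by (simp add: complex_eq_iff)
    moreover have "cis (of_int 1 * \<theta>) + (-1) * cis (of_int (-1) * \<theta>) = of_real (2 * sin \<theta>) * \<i>"
      by (simp add: complex_eq_iff)
    ultimately show ?thesis by (simp only:) (simp add: field_simps)
  qed
  then show ?case
    by (simp only:) (intro trig_poly.add trig_poly_mult trig_poly_const,
        use trig_poly.monom[of 1 1] trig_poly.monom[of 1 "-1"] trig_poly.monom[of "-1" "-1"] in auto)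
next
  case (const c)
  show ?case by (rule trig_poly_const)
next
  case (add f g)
  then show ?case using trig_poly.add by simp
next
  case (mult f g)
  then show ?case using trig_poly_mult by simp
qed

lemma trig_poly_dense:
  assumes G: "continuous_on (sphere 0 1) G" and "\<epsilon> > 0"
  obtains t where "trig_poly t" "\<And>\<theta>. cmod (G (cis \<theta>) - t \<theta>) < \<epsilon>"
proof -
  obtain P where P: "polynomial_function P" "\<And>z. z \<in> sphere 0 1 \<Longrightarrow> norm (G z - P z) < \<epsilon>"
    using Stone_Weierstrass_polynomial_function[OF compact_sphere G \<open>\<epsilon> > 0\<close>] by blast
  have "real_polynomial_function (Re \<circ> P)" "real_polynomial_function (Im \<circ> P)"
    using P(1) bounded_linear_Re bounded_linear_Im unfolding polynomial_function_def by blast+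
  then have "trig_poly (\<lambda>\<theta>. complex_of_real ((Re \<circ> P) (cis \<theta>)) + \<i> * complex_of_real ((Im \<circ> P) (cis \<theta>)))"
    by (intro trig_poly.add trig_poly_mult trig_poly_const trig_poly_real_polynomial_function)
  then have "trig_poly (\<lambda>\<theta>. P (cis \<theta>))" by (simp add: complex_eq[symmetric])
  then show thesis using P(2) by (intro that) auto
qed

text \<open>The cutoff vanishes in a neighbourhood of \<open>-1\<close>, the only point of the circle at which \<open>Arg\<close> jumps.
  Hence any continuous function on the line, transported by \<open>Arg\<close>, becomes continuous on the circle.\<close>

lemma circle_cutoff_continuous:
  fixes h :: "real \<Rightarrow> complex" and n :: nat
  assumes h: "continuous_on UNIV h" and "n > 0"
  shows "continuous_on (sphere 0 1)
    (\<lambda>z. of_real (min 1 (max 0 (real n * (1 + Re z) - 1))) * h (c * Arg z))"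
proof -
  let ?G = "\<lambda>z. complex_of_real (min 1 (max 0 (real n * (1 + Re z) - 1))) * h (c * Arg z)"
  let ?B = "{z. Re z < -1 + 1 / real n}"
  have "continuous_on (-\<real>\<^sub>\<le>\<^sub>0) ?G"
    by (intro continuous_intros continuous_on_compose2[OF h]) auto
  moreover have "continuous_on ?B ?G"
  proof -
    have "?G z = 0" if "z \<in> ?B" for z
      using that \<open>n > 0\<close> by (simp add: field_simps max_def min_def)
    then show ?thesis by (subst continuous_on_cong[OF refl, of _ _ "\<lambda>_. 0"]) auto
  qed
  moreover have "open ?B" by (intro open_Collect_less continuous_intros)
  moreover have "open (- (\<real>\<^sub>\<le>\<^sub>0 :: complex set))" by (simp add: open_Compl)
  ultimately have "continuous_on (-\<real>\<^sub>\<le>\<^sub>0 \<union> ?B) ?G" by (intro continuous_on_open_Un) auto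
  then show ?thesis
  proof (rule continuous_on_subset, intro subsetI)
    fix z :: complex assume z: "z \<in> sphere 0 1"
    show "z \<in> -\<real>\<^sub>\<le>\<^sub>0 \<union> ?B"
    proof (cases "z \<in> \<real>\<^sub>\<le>\<^sub>0")
      case True
      then have "z = -1" using z by (auto simp: complex_nonpos_Reals_iff complex_eq_iff cmod_def)
      then show ?thesis using \<open>n > 0\<close> by simp
    qed auto
  qed
qed

section \<open>Completeness of the exponentials on a symmetric interval\<close>

text \<open>The endpoint is \<open>arccos (1 - \<omega>) / (2 * pi)\<close>.  For \<open>\<omega> = 2\<close> it is \<open>1/2\<close>, and then \<open>\<Omega>\<close> is the whole half-open
  torus; the intersection with \<open>torus\<close> treats both cases alike.\<close>

lemma Omega_eq_interval:
  assumes "0 < \<omega>" "\<omega> \<le> 2"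
  obtains b where "0 < b" "b \<le> 1/2" "Omega \<omega> = {-b..b} \<inter> torus"
proof
  define b where "b = arccos (1 - \<omega>) / (2 * pi)"
  have pos: "0 < arccos (1 - \<omega>)"
    using arccos_less_arccos[of "1 - \<omega>" 1] assms by simp
  have le: "arccos (1 - \<omega>) \<le> pi" using assms by (intro arccos_ubound) auto
  show "0 < b" using pos by (simp add: b_def)
  show "b \<le> 1/2" using le by (simp add: b_def field_simps)
  have "phi \<xi> \<in> {0..\<omega>} \<longleftrightarrow> \<xi> \<in> {-b..b}" if "\<xi> \<in> torus" for \<xi>
  proof -
    have "\<bar>\<xi>\<bar> \<le> 1/2" using that by (auto simp: torus_def)
    then have range: "\<bar>2 * pi * \<xi>\<bar> \<le> pi" by (simp add: abs_mult)
    have "phi \<xi> \<in> {0..\<omega>} \<longleftrightarrow> cos (arccos (1 - \<omega>)) \<le> cos \<bar>2 * pi * \<xi>\<bar>"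
      using assms by (auto simp: phi_def cos_arccos)
    also have "\<dots> \<longleftrightarrow> \<bar>2 * pi * \<xi>\<bar> \<le> arccos (1 - \<omega>)"
      using pos le range by (intro cos_mono_le_eq) auto
    also have "\<dots> \<longleftrightarrow> \<bar>\<xi>\<bar> \<le> b" by (simp add: b_def abs_mult field_simps)
    finally show ?thesis by auto
  qed
  then show "Omega \<omega> = {-b..b} \<inter> torus" unfolding Omega_def by blast
qed

locale torus_interval =
  fixes b :: real and \<Omega> :: "real set" and s :: "nat \<Rightarrow> int"
  assumes b: "0 < b" "b \<le> 1/2" and \<Omega>: "\<Omega> = {-b..b} \<inter> torus" and s: "bij s"
begin

lemma \<Omega>_sets [simp, measurable]: "\<Omega> \<in> sets lebesgue"
  unfolding \<Omega> by (intro sets.Int torus_sets) simp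

lemma \<Omega>_sets_torus [simp, measurable]: "\<Omega> \<in> sets torus_measure"
  by (simp add: sets_restrict_space_iff) (simp add: \<Omega>)

lemma measure_\<Omega>: "measure lebesgue \<Omega> = 2 * b"
proof -
  have *: "{-b<..<b} \<subseteq> \<Omega>" "\<Omega> \<subseteq> {-b..b}" using b by (auto simp: \<Omega> torus_def)
  have lm: "\<Omega> \<in> lmeasurable"
    using *(2) by (intro bounded_set_imp_lmeasurable bounded_subset[OF bounded_closed_interval[of "-b" b]]) auto
  have "measure lebesgue {-b<..<b} \<le> measure lebesgue \<Omega>"
    using * lm by (intro measure_mono_fmeasurable) auto
  moreover have "measure lebesgue \<Omega> \<le> measure lebesgue {-b..b}"
    using * lm by (intro measure_mono_fmeasurable) auto
  ultimately show ?thesis using b by (simp add: measure_completion)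
qed

lemma exp_basis_eq:
  "exp_basis \<Omega> s j \<xi> = of_real (1 / sqrt (2 * b)) * indicator \<Omega> \<xi> * cis (of_int (s j) * (pi * \<xi> / b))"
  using b by (simp add: exp_basis_def measure_\<Omega> cis_conv_exp mult_ac)

lemma continuous_measurable_torus:
  fixes h :: "real \<Rightarrow> complex"
  assumes "continuous_on UNIV h"
  shows "h \<in> borel_measurable torus_measure"
  by (intro continuous_imp_measurable_on_sets_lebesgue continuous_on_subset[OF assms]) auto

lemma indicator_times_measurable:
  fixes h :: "real \<Rightarrow> complex"
  assumes "continuous_on UNIV h"
  shows "(\<lambda>\<xi>. indicator \<Omega> \<xi> * h \<xi>) \<in> borel_measurable torus_measure"
  by (intro borel_measurable_times continuous_measurable_torus assms borel_measurable_indicator) simp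

lemma exp_basis_L2: "exp_basis \<Omega> s j \<in> L2_torus"
proof (rule L2_torus_bounded)
  show "exp_basis \<Omega> s j \<in> borel_measurable torus_measure"
    unfolding exp_basis_eq[abs_def] mult.assoc
    using b by (intro borel_measurable_times borel_measurable_const borel_measurable_indicator
        continuous_measurable_torus continuous_intros \<Omega>_sets_torus) auto
  show "AE \<xi> in torus_measure. cmod (exp_basis \<Omega> s j \<xi>) \<le> 1 / sqrt (2 * b)"
    using b by (intro AE_I2) (auto simp: exp_basis_eq norm_mult indicator_def norm_divide)
qed

text \<open>The fundamental theorem of calculus on \<open>\<Omega>\<close>, which differs from the closed interval at most by its
  right endpoint.\<close>

lemma integral_over_interval:
  fixes f F :: "real \<Rightarrow> complex"
  assumes "\<And>x. (F has_vector_derivative f x) (at x)" and f: "continuous_on UNIV f"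
  shows "(LINT \<xi>|torus_measure. indicator \<Omega> \<xi> * f \<xi>) = F b - F (-b)"
proof -
  have meas [measurable]: "f \<in> borel_measurable borel" by (rule borel_measurable_continuous_onI[OF f])
  have "(LINT \<xi>|torus_measure. indicator \<Omega> \<xi> * f \<xi>)
      = (LINT \<xi>|lebesgue. indicator torus \<xi> *\<^sub>R (indicator \<Omega> \<xi> * f \<xi>))"
    by (rule integral_restrict_space) simp
  also have "\<dots> = (LINT \<xi>|lebesgue. indicator {-b..b} \<xi> *\<^sub>R f \<xi>)"
  proof (rule integral_cong_AE)
    show "(\<lambda>\<xi>. indicator torus \<xi> *\<^sub>R (indicator \<Omega> \<xi> * f \<xi>)) \<in> borel_measurable lebesgue"
      by (intro borel_measurable_scaleR borel_measurable_times borel_measurable_indicator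
          measurable_completion) auto
    show "(\<lambda>\<xi>. indicator {-b..b} \<xi> *\<^sub>R f \<xi>) \<in> borel_measurable lebesgue"
      by (intro measurable_completion) simp
    have "AE \<xi> in lebesgue. \<xi> \<noteq> b"
      by (rule AE_I'[of "{b}"]) (auto simp: negligible_iff_null_sets[symmetric])
    then show "AE \<xi> in lebesgue. indicator torus \<xi> *\<^sub>R (indicator \<Omega> \<xi> * f \<xi>) = indicator {-b..b} \<xi> *\<^sub>R f \<xi>"
      by eventually_elim (use b in \<open>auto simp: \<Omega> torus_def indicator_def\<close>)
  qed
  also have "\<dots> = (LINT \<xi>|lborel. indicator {-b..b} \<xi> *\<^sub>R f \<xi>)"
    by (rule integral_completion) simp
  also have "\<dots> = F b - F (-b)"
  proof (rule has_bochner_integral_integral_eq, rule has_bochner_integral_FTC_Icc)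
    show "(F has_vector_derivative f x) (at x within {-b..b})" for x
      using assms(1) by (rule has_vector_derivative_at_within)
    show "continuous_on {-b..b} f" using f continuous_on_subset by blast
  qed (use b in simp)
  finally show ?thesis .
qed

lemma integral_cis:
  fixes m :: int
  shows "(LINT \<xi>|torus_measure. indicator \<Omega> \<xi> * cis (of_int m * (pi * \<xi> / b)))
    = (if m = 0 then of_real (2 * b) else 0)"
proof (cases "m = 0")
  case True
  have "(LINT \<xi>|torus_measure. indicator \<Omega> \<xi> * (1 :: complex)) = of_real b - of_real (-b)"
    by (rule integral_over_interval) (auto intro!: derivative_eq_intros has_vector_derivative_of_real)
  then show ?thesis using True by simp
next
  case False
  define c where "c = of_int m * pi / b"
  have c: "c \<noteq> 0" using False b by (simp add: c_def)
  have "(LINT \<xi>|torus_measure. indicator \<Omega> \<xi> * cis (c * \<xi>)) = cis (c * b) / (\<i> * of_real c) - cis (c * (- b)) / (\<i> * of_real c)"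
  proof (rule integral_over_interval)
    fix x :: real
    have "((\<lambda>z. exp (\<i> * of_real c * z) / (\<i> * of_real c)) has_field_derivative exp (\<i> * of_real c * of_real x)) (at (of_real x))"
      using c by (auto intro!: derivative_eq_intros)
    then have "((\<lambda>x. exp (\<i> * of_real c * of_real x) / (\<i> * of_real c)) has_vector_derivative exp (\<i> * of_real c * of_real x)) (at x)"
      by (rule has_vector_derivative_real_field)
    then show "((\<lambda>x. cis (c * x) / (\<i> * of_real c)) has_vector_derivative cis (c * x)) (at x)"
      by (simp add: cis_conv_exp mult_ac)
  qed (intro continuous_intros)
  also have "cis (c * b) = cis (c * (- b))"
  proof -
    have "c * b = c * (- b) + 2 * pi * of_int m" using b by (simp add: c_def)
    then have "cis (c * b) = cis (c * (- b)) * cis (2 * pi * of_int m)" by (simp only: cis_mult)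
    then show ?thesis by simp
  qed
  finally have "(LINT \<xi>|torus_measure. indicator \<Omega> \<xi> * cis (c * \<xi>)) = 0" by simp
  moreover have "of_int m * (pi * \<xi> / b) = c * \<xi>" for \<xi> by (simp add: c_def)
  ultimately show ?thesis using False by (simp only: if_False)
qed

lemma exp_basis_orthonormal:
  "L2_inner (exp_basis \<Omega> s i) (exp_basis \<Omega> s j) = (if i = j then 1 else 0)"
proof -
  have "exp_basis \<Omega> s i \<xi> * cnj (exp_basis \<Omega> s j \<xi>)
      = of_real (1 / (2 * b)) * (indicator \<Omega> \<xi> * cis (of_int (s i - s j) * (pi * \<xi> / b)))" for \<xi>
  proof -
    have "cis (of_int (s i - s j) * (pi * \<xi> / b))
        = cis (of_int (s i) * (pi * \<xi> / b)) * cnj (cis (of_int (s j) * (pi * \<xi> / b)))"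
      by (simp add: cis_cnj cis_mult algebra_simps diff_divide_distrib)
    moreover have "complex_of_real (1 / sqrt (2 * b)) * of_real (1 / sqrt (2 * b)) = of_real (1 / (2 * b))"
      unfolding of_real_mult[symmetric] using b by simp
    ultimately show ?thesis unfolding exp_basis_eq
      by (simp add: indicator_def del: of_real_divide)
  qed
  then have "L2_inner (exp_basis \<Omega> s i) (exp_basis \<Omega> s j)
      = of_real (1 / (2 * b)) * (if s i - s j = 0 then of_real (2 * b) else 0)"
    unfolding L2_inner_def by (simp only: integral_mult_right_zero integral_cis)
  moreover have "s i = s j \<longleftrightarrow> i = j" using bij_is_inj[OF s] by (auto dest: injD)
  ultimately show ?thesis using b by simp
qed

lemma trig_poly_in_span:
  assumes "trig_poly t"
  shows "\<exists>N c. \<forall>\<xi>. indicator \<Omega> \<xi> * t (pi * \<xi> / b) = (\<Sum>j<N. c j * exp_basis \<Omega> s j \<xi>)"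
  using assms
proof induction
  case (monom d k)
  obtain i where i: "k = s i" using bij_is_surj[OF s] by blast
  let ?c = "\<lambda>j. if j = i then d * of_real (sqrt (2 * b)) else 0"
  have "indicator \<Omega> \<xi> * (d * cis (of_int k * (pi * \<xi> / b))) = (\<Sum>j<Suc i. ?c j * exp_basis \<Omega> s j \<xi>)" for \<xi>
  proof -
    have "(\<Sum>j<Suc i. ?c j * exp_basis \<Omega> s j \<xi>) = d * of_real (sqrt (2 * b)) * exp_basis \<Omega> s i \<xi>"
      by simp
    also have "\<dots> = d * (of_real (sqrt (2 * b)) * of_real (1 / sqrt (2 * b))) * (indicator \<Omega> \<xi> * cis (of_int k * (pi * \<xi> / b)))"
      unfolding exp_basis_eq i by (simp only: mult_ac)
    also have "complex_of_real (sqrt (2 * b)) * of_real (1 / sqrt (2 * b)) = 1"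
      unfolding of_real_mult[symmetric] using b by simp
    finally show ?thesis by (simp only: mult_1_left mult_1_right mult_ac)
  qed
  then show ?case by (intro exI[of _ "Suc i"] exI[of _ ?c] allI)
next
  case (add f g)
  obtain N c M d where cd: "\<And>\<xi>. indicator \<Omega> \<xi> * f (pi * \<xi> / b) = (\<Sum>j<N. c j * exp_basis \<Omega> s j \<xi>)"
    "\<And>\<xi>. indicator \<Omega> \<xi> * g (pi * \<xi> / b) = (\<Sum>j<M. d j * exp_basis \<Omega> s j \<xi>)"
    using add.IH by blast
  let ?h = "\<lambda>j. (if j < N then c j else 0) + (if j < M then d j else 0)"
  have "indicator \<Omega> \<xi> * (f (pi * \<xi> / b) + g (pi * \<xi> / b)) = (\<Sum>j<max N M. ?h j * exp_basis \<Omega> s j \<xi>)" for \<xi>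
  proof -
    have "(\<Sum>j<N. c j * exp_basis \<Omega> s j \<xi>) = (\<Sum>j<max N M. (if j < N then c j else 0) * exp_basis \<Omega> s j \<xi>)"
      "(\<Sum>j<M. d j * exp_basis \<Omega> s j \<xi>) = (\<Sum>j<max N M. (if j < M then d j else 0) * exp_basis \<Omega> s j \<xi>)"
      by (rule sum.mono_neutral_cong_left; auto)+
    then show ?thesis by (simp add: distrib_left distrib_right sum.distrib cd)
  qed
  then show ?case by (intro exI[of _ "max N M"] exI[of _ ?h] allI)
qed

lemma circle_function_approximable:
  assumes G: "continuous_on (sphere 0 1) G"
  defines "f \<equiv> \<lambda>\<xi>. indicator \<Omega> \<xi> * G (cis (pi * \<xi> / b))"
  shows "f \<in> L2_torus" "L2_approximable (exp_basis \<Omega> s) f"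
proof -
  interpret finite_measure torus_measure by (rule finite_measure_torus)
  have cont: "continuous_on UNIV (\<lambda>\<xi>. G (cis (pi * \<xi> / b)))"
    using b by (intro continuous_on_compose2[OF G] continuous_intros) auto
  have "bounded (G ` sphere 0 1)"
    by (intro compact_imp_bounded compact_continuous_image G compact_sphere)
  then obtain K where K: "\<And>z. z \<in> sphere 0 1 \<Longrightarrow> cmod (G z) \<le> K" unfolding bounded_iff by blast
  have "cmod (G 1) \<le> K" using K[of 1] by simp
  then have "K \<ge> 0" using norm_ge_zero[of "G 1"] by linarith
  show f: "f \<in> L2_torus"
  proof (rule L2_torus_bounded)
    show "f \<in> borel_measurable torus_measure"
      unfolding f_def by (rule indicator_times_measurable[OF cont])
    show "AE \<xi> in torus_measure. cmod (f \<xi>) \<le> K"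
      using K \<open>K \<ge> 0\<close> by (intro AE_I2) (auto simp: f_def indicator_def)
  qed
  have "\<exists>t. trig_poly t \<and> (\<forall>\<theta>. cmod (G (cis \<theta>) - t \<theta>) < inverse (real (Suc n)))" for n
    by (rule trig_poly_dense[OF G, of "inverse (real (Suc n))"]) auto
  then obtain t where t: "\<And>n. trig_poly (t n)"
    "\<And>n \<theta>. cmod (G (cis \<theta>) - t n \<theta>) < inverse (real (Suc n))" by metis
  define u where "u n \<xi> = indicator \<Omega> \<xi> * t n (pi * \<xi> / b)" for n \<xi>
  have span: "\<exists>N c. u n = (\<lambda>\<xi>. \<Sum>j<N. c j * exp_basis \<Omega> s j \<xi>)" for n
    using trig_poly_in_span[OF t(1)[of n]] unfolding u_def fun_eq_iff .
  have u: "u n \<in> L2_torus" for n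
  proof -
    obtain N c where "u n = (\<lambda>\<xi>. \<Sum>j<N. c j * exp_basis \<Omega> s j \<xi>)" using span by blast
    then show ?thesis by (simp only:) (intro L2_torus_sum L2_torus_scale exp_basis_L2)
  qed
  have dist: "cmod (f \<xi> - u n \<xi>) \<le> inverse (real (Suc n))" for n \<xi>
    using t(2)[of "pi * \<xi> / b" n] by (cases "\<xi> \<in> \<Omega>") (auto simp: f_def u_def less_imp_le)
  show "L2_approximable (exp_basis \<Omega> s) f"
  proof (rule L2_approximable_limit[OF exp_basis_L2 f u])
    show "L2_approximable (exp_basis \<Omega> s) (u n)" for n
    proof -
      obtain N c where "u n = (\<lambda>\<xi>. \<Sum>j<N. c j * exp_basis \<Omega> s j \<xi>)" using span by blast
      then have "(L2_norm (\<lambda>\<xi>. u n \<xi> - (\<Sum>j<N. c j * exp_basis \<Omega> s j \<xi>)))\<^sup>2 = 0"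
        by (simp add: L2_norm_sq)
      then show ?thesis unfolding L2_approximable_def by metis
    qed
    show "(\<lambda>n. (L2_norm (\<lambda>\<xi>. f \<xi> - u n \<xi>))\<^sup>2) \<longlonglongrightarrow> 0"
    proof (rule L2_norm_sq_tendsto_dominated[OF f u, where g = "\<lambda>_. 1"])
      show "AE \<xi> in torus_measure. (\<lambda>n. u n \<xi>) \<longlonglongrightarrow> f \<xi>"
      proof (rule AE_I2)
        fix \<xi>
        have "(\<lambda>n. f \<xi> - u n \<xi>) \<longlonglongrightarrow> 0"
          using dist by (intro Lim_null_comparison[OF _ LIMSEQ_inverse_real_of_nat]) auto
        from tendsto_diff[OF tendsto_const[of "f \<xi>"] this] show "(\<lambda>n. u n \<xi>) \<longlonglongrightarrow> f \<xi>" by simp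
      qed
      show "AE \<xi> in torus_measure. (cmod (f \<xi> - u n \<xi>))\<^sup>2 \<le> 1" for n
      proof (rule AE_I2)
        fix \<xi>
        have "inverse (real (Suc n)) \<le> 1" by (simp add: inverse_le_1_iff)
        then have "cmod (f \<xi> - u n \<xi>) \<le> 1" using dist[of \<xi> n] by linarith
        then show "(cmod (f \<xi> - u n \<xi>))\<^sup>2 \<le> 1" by (intro power_le_one) auto
      qed
    qed simp
  qed
qed

lemma AE_torus_negligible:
  assumes "negligible S"
  shows "AE \<xi> in torus_measure. \<xi> \<notin> S"
proof -
  have "AE \<xi> in lebesgue. \<xi> \<notin> S"
    using assms by (intro AE_I'[of S]) (auto simp: negligible_iff_null_sets)
  then show ?thesis by (subst AE_restrict_space_iff) auto
qed

text \<open>By Lebesgue measurability \<open>f\<close> is an almost everywhere limit of continuous functions \<open>g n\<close>.  Clamping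
  them to modulus at most \<open>K\<close> keeps the limit and provides a majorant, and cutting them off near the
  endpoints turns them into functions on the circle.  The cutoffs tend to \<open>1\<close> inside the interval.\<close>

lemma bounded_function_approximable:
  assumes f: "f \<in> L2_on \<Omega>" and K: "K > 0" "\<And>\<xi>. cmod (f \<xi>) \<le> K"
  shows "L2_approximable (exp_basis \<Omega> s) f"
proof -
  interpret finite_measure torus_measure by (rule finite_measure_torus)
  have fL2: "f \<in> L2_torus" by (rule L2_onD(1)[OF f])
  have "(\<lambda>x. if x \<in> torus then f x else 0) \<in> borel_measurable lebesgue"
    using L2_torusD(1)[OF fL2] by (simp add: borel_measurable_if)
  then have "(\<lambda>x. if x \<in> torus then f x else 0) measurable_on UNIV"
    by (intro lebesgue_measurable_imp_measurable_on) auto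
  then obtain S g where S: "negligible S" and g: "\<And>n. continuous_on UNIV (g n)"
    and lim: "\<And>x. x \<notin> S \<Longrightarrow> (\<lambda>n. g n x) \<longlonglongrightarrow> (if x \<in> torus then f x else 0)"
    unfolding measurable_on_def by auto
  define h where "h n x = g n x / of_real (max 1 (cmod (g n x) / K))" for n :: nat and x
  have h: "continuous_on UNIV (h n)" for n
    unfolding h_def using K by (intro continuous_intros g) auto
  have h_le: "cmod (h n x) \<le> K" for n x
    using K by (auto simp: h_def norm_divide max_def field_simps)
  define G where "G n z = of_real (min 1 (max 0 (real (Suc n) * (1 + Re z) - 1))) * h n (b / pi * Arg z)" for n :: nat and z :: complex
  have G: "continuous_on (sphere 0 1) (G n)" for n
    unfolding G_def by (intro circle_cutoff_continuous h) simp
  have G_le: "cmod (G n z) \<le> K" for n z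
  proof -
    have "\<bar>min 1 (max 0 (real (Suc n) * (1 + Re z) - 1))\<bar> \<le> 1" by simp
    then have "\<bar>min 1 (max 0 (real (Suc n) * (1 + Re z) - 1))\<bar> * cmod (h n (b / pi * Arg z)) \<le> 1 * K"
      using h_le by (intro mult_mono) auto
    then show ?thesis by (simp only: G_def norm_mult norm_of_real mult_1)
  qed
  define u where "u n \<xi> = indicator \<Omega> \<xi> * G n (cis (pi * \<xi> / b))" for n \<xi>
  have u_le: "cmod (u n \<xi>) \<le> K" for n \<xi>
    using G_le K by (auto simp: u_def indicator_def)
  show ?thesis
  proof (rule L2_approximable_limit[OF exp_basis_L2 fL2])
    show u: "u n \<in> L2_torus" "L2_approximable (exp_basis \<Omega> s) (u n)" for n
      using circle_function_approximable[OF G[of n]] unfolding u_def by auto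
    show "(\<lambda>n. (L2_norm (\<lambda>\<xi>. f \<xi> - u n \<xi>))\<^sup>2) \<longlonglongrightarrow> 0"
    proof (rule L2_norm_sq_tendsto_dominated[OF fL2 u(1), where g = "\<lambda>_. (2 * K)\<^sup>2"])
      have neg: "negligible (S \<union> {-b, b})" using S by (simp add: negligible_Un)
      have torus: "AE \<xi> in torus_measure. \<xi> \<in> torus"
        by (rule AE_I2) simp
      show "AE \<xi> in torus_measure. (\<lambda>n. u n \<xi>) \<longlonglongrightarrow> f \<xi>"
        using AE_torus_negligible[OF neg] L2_onD(2)[OF f] torus
      proof eventually_elim
        case (elim \<xi>)
        show ?case
        proof (cases "\<xi> \<in> \<Omega>")
          case False
          then show ?thesis using elim by (simp add: u_def)
        next
          case True
          let ?\<theta> = "pi * \<xi> / b"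
          have \<xi>: "-b < \<xi>" "\<xi> < b" using True elim by (auto simp: \<Omega>)
          then have "pi * (- b) < pi * \<xi>" "pi * \<xi> < pi * b"
            by (intro mult_strict_left_mono; simp)+
          then have \<theta>: "-pi < ?\<theta>" "?\<theta> < pi" using b by (auto simp: field_simps)
          then have arg: "b / pi * Arg (cis ?\<theta>) = \<xi>" using b by (simp add: Arg_cis)
          have "cos ?\<theta> > -1"
          proof -
            have "cos pi < cos \<bar>?\<theta>\<bar>" using \<theta> by (intro cos_monotone_0_pi) auto
            then show ?thesis by (simp only: cos_pi cos_abs_real)
          qed
          then have pos: "1 + cos ?\<theta> > 0" by simp
          have "\<forall>\<^sub>F n in sequentially. 2 / (1 + cos ?\<theta>) \<le> real n"
            using filterlim_real_sequentially by (simp add: filterlim_at_top)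
          then have "\<forall>\<^sub>F n in sequentially. min 1 (max 0 (real (Suc n) * (1 + Re (cis ?\<theta>)) - 1)) = 1"
          proof eventually_elim
            case (elim n)
            then have "2 \<le> real n * (1 + cos ?\<theta>)" using pos by (simp add: field_simps)
            also have "\<dots> \<le> real (Suc n) * (1 + cos ?\<theta>)" using pos by (intro mult_right_mono) auto
            finally show ?case by simp
          qed
          then have "\<forall>\<^sub>F n in sequentially. u n \<xi> = h n \<xi>"
            by eventually_elim (use True in \<open>simp only: u_def G_def arg, simp\<close>)
          moreover have "(\<lambda>n. h n \<xi>) \<longlonglongrightarrow> f \<xi>"
          proof -
            have "(\<lambda>n. g n \<xi>) \<longlonglongrightarrow> f \<xi>" using lim[of \<xi>] elim by auto
            then have "(\<lambda>n. h n \<xi>) \<longlonglongrightarrow> f \<xi> / of_real (max 1 (cmod (f \<xi>) / K))"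
              unfolding h_def using K by (intro tendsto_intros) auto
            moreover have "max 1 (cmod (f \<xi>) / K) = 1" using K by (intro max_absorb1) simp
            ultimately show ?thesis by simp
          qed
          ultimately show ?thesis by (rule tendsto_cong[THEN iffD2])
        qed
      qed
      show "AE \<xi> in torus_measure. (cmod (f \<xi> - u n \<xi>))\<^sup>2 \<le> (2 * K)\<^sup>2" for n
      proof (rule AE_I2, rule power_mono)
        show "cmod (f \<xi> - u n \<xi>) \<le> 2 * K" for \<xi>
          using norm_triangle_ineq4[of "f \<xi>" "u n \<xi>"] K(2)[of \<xi>] u_le[of n \<xi>] by linarith
      qed simp
    qed simp
  qed
qed

text \<open>Cutting \<open>f\<close> off where its modulus is large reduces the claim to bounded functions; \<open>\<bar>f\<bar>\<^sup>2\<close> is the majorant.\<close>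

lemma exp_basis_complete:
  assumes f: "f \<in> L2_on \<Omega>"
  shows "L2_approximable (exp_basis \<Omega> s) f"
proof -
  have fL2: "f \<in> L2_torus" by (rule L2_onD(1)[OF f])
  note [measurable] = L2_torusD(1)[OF fL2]
  define u where "u n \<xi> = (if cmod (f \<xi>) \<le> real (Suc n) then f \<xi> else 0)" for n \<xi>
  have u_on: "u n \<in> L2_on \<Omega>" for n
  proof -
    have "u n \<in> L2_torus"
    proof (rule L2_torus_bounded)
      show "u n \<in> borel_measurable torus_measure" unfolding u_def by measurable
      show "AE \<xi> in torus_measure. cmod (u n \<xi>) \<le> real (Suc n)" by (rule AE_I2) (simp add: u_def)
    qed
    moreover have "AE \<xi> in torus_measure. \<xi> \<notin> \<Omega> \<longrightarrow> u n \<xi> = 0"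
      using L2_onD(2)[OF f] by eventually_elim (auto simp: u_def)
    ultimately show ?thesis by (simp add: L2_on_def)
  qed
  show ?thesis
  proof (rule L2_approximable_limit[OF exp_basis_L2 fL2])
    show u: "u n \<in> L2_torus" for n by (rule L2_onD(1)[OF u_on])
    show "L2_approximable (exp_basis \<Omega> s) (u n)" for n
      by (rule bounded_function_approximable[OF u_on, of "real (Suc n)"]) (auto simp: u_def)
    show "(\<lambda>n. (L2_norm (\<lambda>\<xi>. f \<xi> - u n \<xi>))\<^sup>2) \<longlonglongrightarrow> 0"
    proof (rule L2_norm_sq_tendsto_dominated[OF fL2 u L2_torusD(2)[OF fL2]])
      show "AE \<xi> in torus_measure. (\<lambda>n. u n \<xi>) \<longlonglongrightarrow> f \<xi>"
      proof (rule AE_I2, rule tendsto_eventually)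
        fix \<xi>
        have "\<forall>\<^sub>F n in sequentially. cmod (f \<xi>) \<le> real n"
          using filterlim_real_sequentially by (simp add: filterlim_at_top)
        then show "\<forall>\<^sub>F n in sequentially. u n \<xi> = f \<xi>"
          by eventually_elim (simp add: u_def)
      qed
      show "AE \<xi> in torus_measure. (cmod (f \<xi> - u n \<xi>))\<^sup>2 \<le> (cmod (f \<xi>))\<^sup>2" for n
        by (rule AE_I2) (simp add: u_def)
    qed
  qed
qed

end

section \<open>Orbits of the diagonal operator\<close>

text \<open>Partial products over the first \<open>N\<close> nodes decrease to the infinite product, so the infimum of the
  infinite products bounds all of them from below.  Hence every finite
  subfamily inherits the separation constant.\<close>

lemma uniformly_separatedD:
  assumes "uniformly_separated l"
  obtains \<delta> where "\<delta> > 0"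
    "\<And>N j. \<delta> \<le> (\<Prod>k\<in>{..<N} - {j}. pseudo_dist (l j) (l k))"
proof -
  define P where "P j N = (\<Prod>k\<in>{..<N} - {j}. pseudo_dist (l j) (l k))" for j N
  have disc: "cmod (l j) < 1" for j using assms by (simp add: uniformly_separated_def)
  have pd: "0 \<le> pseudo_dist (l j) (l k)" "pseudo_dist (l j) (l k) \<le> 1" for j k
  proof -
    show "0 \<le> pseudo_dist (l j) (l k)" by (simp add: pseudo_dist_def)
    have "1 - (pseudo_dist (l j) (l k))\<^sup>2 \<ge> 0"
      unfolding one_minus_pseudo_dist_sq[OF disc disc]
      using cmod_sq_less_1[OF disc[of j]] cmod_sq_less_1[OF disc[of k]] by simp
    then have "(pseudo_dist (l j) (l k))\<^sup>2 \<le> 1\<^sup>2" by simp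
    then show "pseudo_dist (l j) (l k) \<le> 1" by (rule power2_le_imp_le) simp
  qed
  have "decseq (P j)" for j
  proof (rule decseq_SucI)
    fix N
    show "P j (Suc N) \<le> P j N"
    proof (cases "N = j")
      case True
      then have "{..<Suc N} - {j} = {..<N} - {j}" by auto
      then show ?thesis by (simp add: P_def)
    next
      case False
      then have "{..<Suc N} - {j} = insert N ({..<N} - {j})" by auto
      moreover have "0 \<le> P j N" unfolding P_def using pd by (intro prod_nonneg) auto
      ultimately show ?thesis using pd[of j N] by (simp add: P_def mult_left_le_one_le)
    qed
  qed
  moreover have P0: "0 \<le> P j N" for j N unfolding P_def using pd by (intro prod_nonneg) auto
  ultimately have conv: "P j \<longlonglongrightarrow> lim (P j)" and ge: "lim (P j) \<le> P j N" for j N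
  proof -
    from \<open>decseq (P j)\<close> P0 obtain L where L: "P j \<longlonglongrightarrow> L" "\<And>i. L \<le> P j i"
      using decseq_convergent[of "P j" 0] by blast
    then show "P j \<longlonglongrightarrow> lim (P j)" "lim (P j) \<le> P j N" by (auto simp: limI)
  qed
  have "0 \<le> lim (P j)" for j using P0 by (intro LIMSEQ_le_const[OF conv]) auto
  then have "bdd_below (range (\<lambda>j. lim (P j)))" by (intro bdd_belowI[of _ 0]) auto
  then have le: "(INF j. lim (P j)) \<le> lim (P j)" for j by (rule cINF_lower) simp
  show thesis
  proof
    show "(INF j. lim (P j)) > 0"
      using assms unfolding uniformly_separated_def P_def[abs_def] pseudo_dist_def by blast
    show "(INF j. lim (P j)) \<le> (\<Prod>k\<in>{..<N} - {j}. pseudo_dist (l j) (l k))" for N j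
      using le[of j] ge[of j N] unfolding P_def by linarith
  qed
qed

context torus_interval
begin

text \<open>Inner products are continuous with respect to convergence in the mean, so the coefficients of the
  series can be read off termwise.\<close>

lemma diagonal_operator_coeff:
  assumes f: "f \<in> L2_on \<Omega>"
    and T: "L2_sums \<Omega> (\<lambda>j \<xi>. l j * L2_inner f (exp_basis \<Omega> s j) * exp_basis \<Omega> s j \<xi>) g"
  shows "g \<in> L2_on \<Omega>" "L2_inner g (exp_basis \<Omega> s j) = l j * L2_inner f (exp_basis \<Omega> s j)"
proof -
  let ?e = "exp_basis \<Omega> s"
  let ?u = "\<lambda>N \<xi>. \<Sum>j<N. l j * L2_inner f (?e j) * ?e j \<xi>"
  show g: "g \<in> L2_on \<Omega>" using T by (simp add: L2_sums_def)
  have u: "?u N \<in> L2_torus" for N by (intro L2_torus_sum L2_torus_scale exp_basis_L2)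
  have "(\<lambda>N. L2_inner (?u N) (?e j)) \<longlonglongrightarrow> L2_inner g (?e j)"
    using T by (intro L2_inner_tendsto u L2_onD(1)[OF g] exp_basis_L2) (simp add: L2_sums_def)
  moreover have "\<forall>\<^sub>F N in sequentially. L2_inner (?u N) (?e j) = l j * L2_inner f (?e j)"
    using eventually_gt_at_top[of j]
  proof eventually_elim
    case (elim N)
    have "L2_inner (?u N) (?e j) = (\<Sum>i<N. l i * L2_inner f (?e i) * (if i = j then 1 else 0))"
      by (simp add: L2_inner_sum_left L2_torus_scale exp_basis_L2 L2_inner_scale_left exp_basis_orthonormal)
    also have "\<dots> = (\<Sum>i\<in>{j}. l i * L2_inner f (?e i) * (if i = j then 1 else 0))"
      using elim by (intro sum.mono_neutral_right) auto
    finally show ?case by simp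
  qed
  ultimately show "L2_inner g (?e j) = l j * L2_inner f (?e j)"
    by (rule LIMSEQ_unique[OF _ tendsto_eventually])
qed

text \<open>The frame property in terms of the Riesz bounds: the lower frame bound uses
  \<open>1 - \<bar>l j\<bar>\<^sup>2 \<le> C \<bar>a j\<bar>\<^sup>2\<close> and the upper one \<open>c \<bar>a j\<bar>\<^sup>2 \<le> 1 - \<bar>l j\<bar>\<^sup>2\<close>.\<close>

lemma frame_of_orbit:
  assumes sep: "uniformly_separated l"
    and T: "\<And>f. f \<in> L2_on \<Omega> \<Longrightarrow> L2_sums \<Omega> (\<lambda>j \<xi>. l j * L2_inner f (exp_basis \<Omega> s j) * exp_basis \<Omega> s j \<xi>) (T f)"
    and a: "a \<in> L2_on \<Omega>"
    and comp: "comparable_seqs (\<lambda>j. (cmod (L2_inner a (exp_basis \<Omega> s j)))\<^sup>2) (\<lambda>j. 1 - (cmod (l j))\<^sup>2)"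
  shows "L2_frame \<Omega> (\<lambda>n. (T ^^ n) a)"
proof -
  let ?e = "exp_basis \<Omega> s"
  obtain \<delta> where \<delta>: "\<delta> > 0" "\<And>N j. \<delta> \<le> (\<Prod>k\<in>{..<N} - {j}. pseudo_dist (l j) (l k))"
    using uniformly_separatedD[OF sep] by blast
  have disc: "cmod (l j) < 1" for j using sep by (simp add: uniformly_separated_def)
  have w: "1 - (cmod (l j))\<^sup>2 > 0" for j using cmod_sq_less_1[OF disc] by simp
  obtain c C where c: "c > 0" "C > 0"
    "\<And>j. c * (cmod (L2_inner a (?e j)))\<^sup>2 \<le> 1 - (cmod (l j))\<^sup>2"
    "\<And>j. 1 - (cmod (l j))\<^sup>2 \<le> C * (cmod (L2_inner a (?e j)))\<^sup>2"
    using comp unfolding comparable_seqs_def by blast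
  have orbit: "(T ^^ n) a \<in> L2_on \<Omega> \<and> (\<forall>j. L2_inner ((T ^^ n) a) (?e j) = l j ^ n * L2_inner a (?e j))" for n
  proof (induction n)
    case (Suc n)
    then show ?case using diagonal_operator_coeff[OF _ T, of "(T ^^ n) a"] by auto
  qed (use a in simp)
  define K where "K = riesz_const \<delta>"
  have "K > 0" using \<delta>(1) by (simp add: K_def riesz_const_def)
  have bounds: "summable (\<lambda>n. (cmod (L2_inner f ((T ^^ n) a)))\<^sup>2) \<and>
        1 / (2 * C * K) * (L2_norm f)\<^sup>2 \<le> (\<Sum>n. (cmod (L2_inner f ((T ^^ n) a)))\<^sup>2) \<and>
        (\<Sum>n. (cmod (L2_inner f ((T ^^ n) a)))\<^sup>2) \<le> K / c * (L2_norm f)\<^sup>2"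
    if f: "f \<in> L2_on \<Omega>" for f
  proof -
    define d where "d j = cnj (L2_inner f (?e j)) * L2_inner a (?e j)" for j
    let ?D = "\<lambda>j. (cmod (d j))\<^sup>2 / (1 - (cmod (l j))\<^sup>2)"
    note parseval = L2_parseval[OF exp_basis_L2 exp_basis_orthonormal L2_onD(1) exp_basis_complete]
    have pf: "(\<lambda>j. (cmod (L2_inner f (?e j)))\<^sup>2) sums (L2_norm f)\<^sup>2" by (rule parseval[OF f f])
    have pa: "(\<lambda>j. (cmod (L2_inner a (?e j)))\<^sup>2) sums (L2_norm a)\<^sup>2" by (rule parseval[OF a a])
    have d: "summable (\<lambda>j. cmod (d j))"
    proof (rule summable_comparison_test')
      show "summable (\<lambda>j. (cmod (L2_inner f (?e j)))\<^sup>2 + (cmod (L2_inner a (?e j)))\<^sup>2)"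
        using pf pa by (intro summable_add) (auto simp: sums_iff)
      show "norm (cmod (d j)) \<le> (cmod (L2_inner f (?e j)))\<^sup>2 + (cmod (L2_inner a (?e j)))\<^sup>2" for j
      proof -
        have "0 \<le> cmod (L2_inner f (?e j)) * cmod (L2_inner a (?e j))" by simp
        with sum_squares_bound[of "cmod (L2_inner f (?e j))" "cmod (L2_inner a (?e j))"]
        have "cmod (L2_inner f (?e j)) * cmod (L2_inner a (?e j))
            \<le> (cmod (L2_inner f (?e j)))\<^sup>2 + (cmod (L2_inner a (?e j)))\<^sup>2" by linarith
        then show ?thesis by (simp add: d_def norm_mult)
      qed
    qed
    have upper: "?D j \<le> 1 / c * (cmod (L2_inner f (?e j)))\<^sup>2" for j
    proof -
      have "c * (cmod (d j))\<^sup>2 = (cmod (L2_inner f (?e j)))\<^sup>2 * (c * (cmod (L2_inner a (?e j)))\<^sup>2)"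
        by (simp add: d_def norm_mult power_mult_distrib mult_ac)
      also have "\<dots> \<le> (cmod (L2_inner f (?e j)))\<^sup>2 * (1 - (cmod (l j))\<^sup>2)"
        using c(3) by (intro mult_left_mono) auto
      finally show ?thesis using w[of j] c(1) by (simp add: field_simps)
    qed
    have lower: "1 / C * (cmod (L2_inner f (?e j)))\<^sup>2 \<le> ?D j" for j
    proof -
      have "(cmod (L2_inner f (?e j)))\<^sup>2 * (1 - (cmod (l j))\<^sup>2)
          \<le> (cmod (L2_inner f (?e j)))\<^sup>2 * (C * (cmod (L2_inner a (?e j)))\<^sup>2)"
        using c(4) by (intro mult_left_mono) auto
      also have "\<dots> = C * (cmod (d j))\<^sup>2"
        by (simp add: d_def norm_mult power_mult_distrib mult_ac)
      finally show ?thesis using w[of j] c(2) by (simp add: field_simps)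
    qed
    have D: "summable ?D"
    proof (rule summable_comparison_test')
      show "summable (\<lambda>j. 1 / c * (cmod (L2_inner f (?e j)))\<^sup>2)"
        using pf by (intro summable_mult) (auto simp: sums_iff)
      show "norm (?D j) \<le> 1 / c * (cmod (L2_inner f (?e j)))\<^sup>2" for j
        using upper[of j] w[of j] by simp
    qed
    have "suminf ?D \<le> (\<Sum>j. 1 / c * (cmod (L2_inner f (?e j)))\<^sup>2)"
      using pf by (intro suminf_le upper D summable_mult) (auto simp: sums_iff)
    then have D_le: "suminf ?D \<le> 1 / c * (L2_norm f)\<^sup>2"
      using sums_mult[OF pf, of "1 / c"] by (simp add: sums_iff)
    have "(\<Sum>j. 1 / C * (cmod (L2_inner f (?e j)))\<^sup>2) \<le> suminf ?D"
      using pf by (intro suminf_le lower D summable_mult) (auto simp: sums_iff)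
    then have D_ge: "1 / C * (L2_norm f)\<^sup>2 \<le> suminf ?D"
      using sums_mult[OF pf, of "1 / C"] by (simp add: sums_iff)
    have inner: "(cmod (L2_inner f ((T ^^ n) a)))\<^sup>2 = (cmod (\<Sum>j. d j * l j ^ n))\<^sup>2" for n
    proof -
      have "(\<lambda>j. L2_inner f (?e j) * cnj (l j ^ n * L2_inner a (?e j))) sums L2_inner f ((T ^^ n) a)"
        using L2_inner_expansion[OF exp_basis_L2 exp_basis_orthonormal L2_onD(1)[OF f]
            exp_basis_complete[OF f] L2_onD(1)[OF conjunct1[OF orbit[of n]]]] orbit[of n] by simp
      then have "(\<lambda>j. cnj (L2_inner f (?e j) * cnj (l j ^ n * L2_inner a (?e j)))) sums cnj (L2_inner f ((T ^^ n) a))"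
        by (rule sums_cnj[THEN iffD2])
      then have "(\<lambda>j. d j * l j ^ n) sums cnj (L2_inner f ((T ^^ n) a))"
        by (simp add: d_def mult_ac)
      then show ?thesis by (simp add: sums_iff)
    qed
    note riesz = riesz_upper_infinite[OF disc \<delta>(2) \<delta>(1) d D] riesz_lower_infinite[OF disc \<delta>(2) \<delta>(1) d D]
    have "suminf ?D \<le> 2 * K * (\<Sum>n. (cmod (L2_inner f ((T ^^ n) a)))\<^sup>2)"
      using riesz(3) by (simp add: inner K_def)
    with D_ge have "1 / C * (L2_norm f)\<^sup>2 \<le> 2 * K * (\<Sum>n. (cmod (L2_inner f ((T ^^ n) a)))\<^sup>2)" by linarith
    then have "1 / (2 * C * K) * (L2_norm f)\<^sup>2 \<le> (\<Sum>n. (cmod (L2_inner f ((T ^^ n) a)))\<^sup>2)"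
      using c(2) \<open>K > 0\<close> by (simp add: field_simps)
    moreover have "(\<Sum>n. (cmod (L2_inner f ((T ^^ n) a)))\<^sup>2) \<le> K * suminf ?D"
      using riesz(2) by (simp add: inner K_def)
    moreover have "K * suminf ?D \<le> K * (1 / c * (L2_norm f)\<^sup>2)"
      using D_le \<open>K > 0\<close> by (intro mult_left_mono) auto
    ultimately show ?thesis using riesz(1) by (simp add: inner)
  qed
  show ?thesis
    unfolding L2_frame_def
  proof (intro conjI)
    show "\<forall>n. (T ^^ n) a \<in> L2_on \<Omega>" using orbit by blast
    have pos: "1 / (2 * C * K) > 0" "K / c > 0" using c \<open>K > 0\<close> by auto
    show "\<exists>A>0. \<exists>B>0. \<forall>f\<in>L2_on \<Omega>.
        summable (\<lambda>n. (cmod (L2_inner f ((T ^^ n) a)))\<^sup>2) \<and>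
        A * (L2_norm f)\<^sup>2 \<le> (\<Sum>n. (cmod (L2_inner f ((T ^^ n) a)))\<^sup>2) \<and>
        (\<Sum>n. (cmod (L2_inner f ((T ^^ n) a)))\<^sup>2) \<le> B * (L2_norm f)\<^sup>2"
      by (rule exI[of _ "1 / (2 * C * K)"], rule conjI[OF pos(1)], rule exI[of _ "K / c"],
          rule conjI[OF pos(2) ballI[OF bounds]])
  qed
qed

end

theorem theorem3p8:
  fixes \<omega> :: real and \<Omega> :: "real set"
    and l :: "nat \<Rightarrow> complex" and s :: "nat \<Rightarrow> int"
    and e :: "nat \<Rightarrow> real \<Rightarrow> complex"
    and T :: "(real \<Rightarrow> complex) \<Rightarrow> (real \<Rightarrow> complex)"
    and a :: "real \<Rightarrow> complex"
  assumes "0 < \<omega>" and "\<omega> \<le> 2"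
    and "\<Omega> = Omega \<omega>"
    and "uniformly_separated l"
    and "bij s"
    and "e = exp_basis \<Omega> s"
    and "\<And>f. f \<in> L2_on \<Omega> \<Longrightarrow> L2_sums \<Omega> (\<lambda>j \<xi>. l j * L2_inner f (e j) * e j \<xi>) (T f)"
    and "a \<in> L2_on \<Omega>"
    and "comparable_seqs (\<lambda>j. (cmod (L2_inner a (e j)))\<^sup>2) (\<lambda>j. 1 - (cmod (l j))\<^sup>2)"
  shows "L2_frame \<Omega> (\<lambda>n. (T ^^ n) a)"
proof -
  obtain b where b: "0 < b" "b \<le> 1/2" "Omega \<omega> = {-b..b} \<inter> torus"
    by (rule Omega_eq_interval[OF assms(1,2)])
  interpret torus_interval b \<Omega> s
    by unfold_locales (use b assms(3,5) in simp_all)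
  show ?thesis
    by (rule frame_of_orbit[OF assms(4) assms(7)[unfolded assms(6)] assms(8)
          assms(9)[unfolded assms(6)]])
qed

end
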